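(* Let $P$ be a convex polygon in the plane with no two edges parallel. Then any two LMAPs in $P$ interleave.
   Context: $P$ is regarded as a compact set (boundary $\partial P$ plus interior); its edges are regarded as open segments (not containing their endpoints). A parallelogram lies in $P$ if all four corners lie in $P$. A parallelogram $A_0A_1A_2A_3$ lying in $P$ is locally maximal if there is $\delta>0$ such that every parallelogram $B_0B_1B_2B_3$ lying in $P$ with $|A_iB_i|<\delta$ for all $i$ has area at most that of $A_0A_1A_2A_3$. It is slidable if two of its corners lie in the same (open) edge of $P$, non-slidable otherwise. An LMAP is a locally maximal, non-slidable parallelogram lying in $P$ (every LMAP is inscribed, i.e. its corners lie on $\partial P$). For $X,X'\in\partial P$, $[X\circlearrowright X']$ denotes the closed portion of $\partial P$ traversed when moving clockwise along $\partial P$ from $X$ to $X'$ (just $\{X\}$ if $X=X'$). Two $k$-gons $A=A_0\ldots A_{k-1}$ and $B=B_0\ldots B_{k-1}$ inscribed in $P$, with $A_0,\ldots,A_{k-1}$ in clockwise order and $B_0,\ldots,B_{k-1}$ in clockwise order, interleave if (1) for every $i$ some corner of $B$ lies in $[A_i\circlearrowright A_{i+1}]$, and (2) for every $i$ some corner of $A$ lies in $[B_i\circlearrowright B_{i+1}]$ (subscripts modulo $k$). *)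

theory Defs
  imports "HOL-Analysis.Analysis"
begin

type_synonym pt = "real \<times> real"

definition cross :: "pt \<Rightarrow> pt \<Rightarrow> real" where
  "cross a b = fst a * snd b - snd a * fst b"

text \<open>A convex polygon given by its vertices v 0, ..., v (n-1), listed in clockwise
  order (strictly convex position: every other vertex lies strictly to the right of
  each directed edge).\<close>
definition cw_convex_polygon :: "(nat \<Rightarrow> pt) \<Rightarrow> nat \<Rightarrow> bool" where
  "cw_convex_polygon v n \<longleftrightarrow> 3 \<le> n \<and>
     (\<forall>i<n. \<forall>j<n. j \<noteq> i \<and> j \<noteq> Suc i mod n \<longrightarrow>
        cross (v (Suc i mod n) - v i) (v j - v i) < 0)"

definition polygon :: "(nat \<Rightarrow> pt) \<Rightarrow> nat \<Rightarrow> pt set" where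
  "polygon v n = convex hull (v ` {..<n})"

definition edge :: "(nat \<Rightarrow> pt) \<Rightarrow> nat \<Rightarrow> nat \<Rightarrow> pt set" where
  "edge v n i = open_segment (v i) (v (Suc i mod n))"

definition no_parallel_edges :: "(nat \<Rightarrow> pt) \<Rightarrow> nat \<Rightarrow> bool" where
  "no_parallel_edges v n \<longleftrightarrow>
     (\<forall>i<n. \<forall>j<n. i \<noteq> j \<longrightarrow>
        cross (v (Suc i mod n) - v i) (v (Suc j mod n) - v j) \<noteq> 0)"

text \<open>Clockwise piecewise-linear parametrisation of the boundary, periodic with period n:
  gamma t runs along edge from v k to v (k+1 mod n) for t in [k, k+1].\<close>
definition bpar :: "(nat \<Rightarrow> pt) \<Rightarrow> nat \<Rightarrow> real \<Rightarrow> pt" where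
  "bpar v n t = (let k = nat (\<lfloor>t\<rfloor> mod int n) in
     v k + frac t *\<^sub>R (v (Suc k mod n) - v k))"

definition cw_arc :: "(nat \<Rightarrow> pt) \<Rightarrow> nat \<Rightarrow> pt \<Rightarrow> pt \<Rightarrow> pt set" where
  "cw_arc v n X X' = {bpar v n u | u. \<exists>s t. bpar v n s = X \<and> bpar v n t = X' \<and>
       s \<le> t \<and> t - s < real n \<and> s \<le> u \<and> u \<le> t}"

definition parallelogram :: "(nat \<Rightarrow> pt) \<Rightarrow> bool" where
  "parallelogram A \<longleftrightarrow> A 0 + A 2 = A 1 + A 3"

definition par_area :: "(nat \<Rightarrow> pt) \<Rightarrow> real" where
  "par_area A = \<bar>cross (A 1 - A 0) (A 3 - A 0)\<bar>"

definition lies_in :: "(nat \<Rightarrow> pt) \<Rightarrow> pt set \<Rightarrow> bool" where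
  "lies_in A P \<longleftrightarrow> (\<forall>i<4. A i \<in> P)"

definition locally_maximal :: "(nat \<Rightarrow> pt) \<Rightarrow> nat \<Rightarrow> (nat \<Rightarrow> pt) \<Rightarrow> bool" where
  "locally_maximal v n A \<longleftrightarrow> parallelogram A \<and> lies_in A (polygon v n) \<and>
     (\<exists>\<delta>>0. \<forall>B. parallelogram B \<and> lies_in B (polygon v n) \<and>
        (\<forall>i<4. dist (A i) (B i) < \<delta>) \<longrightarrow> par_area B \<le> par_area A)"

definition slidable :: "(nat \<Rightarrow> pt) \<Rightarrow> nat \<Rightarrow> (nat \<Rightarrow> pt) \<Rightarrow> bool" where
  "slidable v n A \<longleftrightarrow> (\<exists>e<n. \<exists>i<4. \<exists>j<4. i \<noteq> j \<and> A i \<in> edge v n e \<and> A j \<in> edge v n e)"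

definition LMAP :: "(nat \<Rightarrow> pt) \<Rightarrow> nat \<Rightarrow> (nat \<Rightarrow> pt) \<Rightarrow> bool" where
  "LMAP v n A \<longleftrightarrow> locally_maximal v n A \<and> \<not> slidable v n A"

definition clockwise_par :: "(nat \<Rightarrow> pt) \<Rightarrow> bool" where
  "clockwise_par A \<longleftrightarrow> cross (A 1 - A 0) (A 2 - A 1) < 0"

definition interleave :: "(nat \<Rightarrow> pt) \<Rightarrow> nat \<Rightarrow> nat \<Rightarrow> (nat \<Rightarrow> pt) \<Rightarrow> (nat \<Rightarrow> pt) \<Rightarrow> bool" where
  "interleave v n k A B \<longleftrightarrow>
     (\<forall>i<k. \<exists>j<k. B j \<in> cw_arc v n (A i) (A (Suc i mod k))) \<and>
     (\<forall>i<k. \<exists>j<k. A j \<in> cw_arc v n (B i) (B (Suc i mod k)))"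

end

theory Submission
  imports Defs
begin

text \<open>
  Only the first-order condition of local maximality is used: the derivative of the signed area
  at an LMAP \<open>A\<close> is nonpositive towards every parallelogram in \<open>P\<close>. Suppose two consecutive
  corners \<open>A0, A1\<close> lie strictly between two consecutive corners \<open>B0, B1\<close> of another LMAP, and put
  \<open>V0 = A0 - B0\<close>, \<open>V1 = B1 - A1\<close>, \<open>V3 = B3 - A3\<close>.

  The lines \<open>B0 A0\<close> and \<open>B1 A1\<close> meet beyond the cap, for otherwise the side \<open>B0 B1\<close> could be
  translated outwards. If \<open>A3\<close> does not come after \<open>B3\<close>, the same holds for the lines \<open>A3 B3\<close> and
  \<open>A0 B0\<close>. If \<open>V3, V0, V1\<close> turn by less than a half turn, then the area form is negative on
  \<open>B - A\<close>, contradicting the sum of the two first-order conditions along \<open>B - A\<close>. Otherwise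
  \<open>V0, V1, V3\<close> have a positive linear relation, which lets the corners 0, 1, 3 of either
  parallelogram move towards those of the other while corner 2 stays fixed, and the sum of these two
  first-order conditions is violated. So \<open>A3\<close> comes after \<open>B3\<close> and, symmetrically, \<open>A2\<close> before
  \<open>B2\<close>. Then \<open>B0, B1\<close> lie outside the strip spanned by \<open>A0 A3\<close> and \<open>A1 A2\<close> while \<open>B2, B3\<close> lie
  inside it; as \<open>B1 - B0 = B2 - B3\<close>, all corners lie on the border of the strip, which gives two
  parallel edges.
\<close>

subsection \<open>Planar cross product\<close>

lemma cross_simps:
  "cross (a + b) c = cross a c + cross b c" "cross c (a + b) = cross c a + cross c b"
  "cross (a - b) c = cross a c - cross b c" "cross c (a - b) = cross c a - cross c b"
  "cross (x *\<^sub>R a) b = x * cross a b" "cross a (x *\<^sub>R b) = x * cross a b"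
  "cross (- a) b = - cross a b" "cross a (- b) = - cross a b"
  "cross a a = 0" "cross 0 a = 0" "cross a 0 = 0"
  by (simp_all add: cross_def algebra_simps)

lemma cross_commute: "cross b a = - cross a b"
  by (simp add: cross_def)

lemma cross_pluecker: "cross a b * cross c d - cross a c * cross b d + cross a d * cross b c = 0"
  by (simp add: cross_def algebra_simps)

text \<open>Cramer's rule: the source of every explicit linear relation between three plane vectors
  below.\<close>

lemma cross_pluecker_vec:
  "cross a b *\<^sub>R c + cross b c *\<^sub>R a + cross c a *\<^sub>R b = 0"
  by (simp add: cross_def prod_eq_iff algebra_simps)

text \<open>In the closed half-plane to the right of \<open>e\<close> the angular order is linear,
  hence transitive. The Pluecker relation, divided by \<open>cross e y\<close>, makes this
  precise.\<close>

lemma cross_trans: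
  assumes "cross e x \<le> 0" "cross e y < 0" "cross e z < 0" "cross x y < 0" "cross y z < 0"
  shows "cross x z < 0"
proof -
  have "cross e y * cross x z = cross e x * cross y z + cross e z * cross x y"
    using cross_pluecker[of e x y z] by simp
  moreover have "cross e x * cross y z \<ge> 0" "cross e z * cross x y > 0"
    using assms by (auto simp: mult_nonpos_nonpos mult_neg_neg)
  ultimately show ?thesis
    using assms(2) by (smt (verit) mult_nonneg_nonpos mult_commute_abs zero_less_mult_iff)
qed

text \<open>Twice the signed area of a triangle, negative for clockwise triangles.\<close>

definition orient :: "pt \<Rightarrow> pt \<Rightarrow> pt \<Rightarrow> real" where
  "orient p q r = cross (q - p) (r - p)"

lemma orient_rotate: "orient q r p = orient p q r"
  by (simp add: orient_def cross_def algebra_simps)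

lemma orient_refl: "orient p p r = 0" "orient p q q = 0" "orient p q p = 0"
  by (simp_all add: orient_def cross_simps)

lemma orient_affine:
  "orient p q ((1 - x) *\<^sub>R a + x *\<^sub>R b) = (1 - x) * orient p q a + x * orient p q b"
  by (simp add: orient_def cross_def algebra_simps)

subsection \<open>The boundary of a convex polygon\<close>

text \<open>Integer indices let cyclic order be written as \<open>k < l\<close>,
  \<open>l < m\<close>, \<open>m < k + int n\<close>, without wrap-around cases.\<close>

definition vtx :: "(nat \<Rightarrow> pt) \<Rightarrow> nat \<Rightarrow> int \<Rightarrow> pt" where
  "vtx v n k = v (nat (k mod int n))"

definition side :: "(nat \<Rightarrow> pt) \<Rightarrow> nat \<Rightarrow> int \<Rightarrow> pt" where
  "side v n k = vtx v n (k + 1) - vtx v n k"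

lemma vtx_mod_eq: "k mod int n = l mod int n \<Longrightarrow> vtx v n k = vtx v n l"
  by (simp add: vtx_def)

lemma side_mod_eq: "k mod int n = l mod int n \<Longrightarrow> side v n k = side v n l"
  unfolding side_def by (metis mod_add_left_eq vtx_mod_eq)

lemma vtx_shift: "vtx v n (k + int n) = vtx v n k" "vtx v n (k - int n) = vtx v n k"
  by (rule vtx_mod_eq; simp)+

lemma nat_Suc_mod: "n > 0 \<Longrightarrow> Suc (nat (k mod int n)) mod n = nat ((k + 1) mod int n)"
proof -
  assume "n > 0"
  have "int (Suc (nat (k mod int n)) mod n) = (k mod int n + 1) mod int n"
    using \<open>n > 0\<close> by (simp add: zmod_int add.commute)
  also have "\<dots> = (k + 1) mod int n" by (simp add: mod_add_left_eq)
  finally show ?thesis by simp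
qed

lemma bpar_eq_floor:
  assumes "n > 0"
  shows "bpar v n t = vtx v n \<lfloor>t\<rfloor> + frac t *\<^sub>R side v n \<lfloor>t\<rfloor>"
  using nat_Suc_mod[OF assms, of "\<lfloor>t\<rfloor>"] by (simp add: bpar_def Let_def side_def vtx_def)

lemma bpar_on_side:
  assumes "n > 0" "of_int k \<le> t" "t \<le> of_int k + 1"
  shows "bpar v n t = vtx v n k + (t - of_int k) *\<^sub>R side v n k"
proof (cases "t = of_int k + 1")
  case True
  then have "\<lfloor>t\<rfloor> = k + 1" "frac t = 0" by (auto simp: frac_def)
  then show ?thesis using True by (simp add: bpar_eq_floor[OF assms(1)] side_def)
next
  case False
  then have "\<lfloor>t\<rfloor> = k" using assms by linarith
  then show ?thesis by (simp add: bpar_eq_floor[OF assms(1)] frac_def)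
qed

lemma bpar_shift_int:
  assumes "n > 0"
  shows "bpar v n (t + of_int k * real n) = bpar v n t"
proof -
  have "\<lfloor>t + of_int k * real n\<rfloor> = \<lfloor>t\<rfloor> + k * int n"
    using floor_add_int[of t "k * int n"] by simp
  moreover have "vtx v n (\<lfloor>t\<rfloor> + k * int n) = vtx v n \<lfloor>t\<rfloor>"
    "side v n (\<lfloor>t\<rfloor> + k * int n) = side v n \<lfloor>t\<rfloor>"
    by (auto intro: vtx_mod_eq side_mod_eq)
  ultimately show ?thesis by (simp add: bpar_eq_floor[OF assms] frac_def)
qed

lemma bpar_shift:
  assumes "n > 0"
  shows "bpar v n (t + real n) = bpar v n t" "bpar v n (t - real n) = bpar v n t"
  using bpar_shift_int[OF assms, of v t 1] bpar_shift_int[OF assms, of v t "-1"] by simp_all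

lemma bpar_convex_comb:
  assumes "n > 0" "of_int k \<le> t" "t \<le> of_int k + 1"
  shows "bpar v n t = (1 - (t - of_int k)) *\<^sub>R vtx v n k + (t - of_int k) *\<^sub>R vtx v n (k + 1)"
  by (simp add: bpar_on_side[OF assms] side_def algebra_simps)

lemma cross_side_neg:
  assumes "cw_convex_polygon v n" "k + 1 < j" "j < k + int n"
  shows "cross (side v n k) (vtx v n j - vtx v n k) < 0"
proof -
  have n: "n \<ge> 3" using assms by (simp add: cw_convex_polygon_def)
  let ?i = "nat (k mod int n)" and ?j = "nat (j mod int n)"
  have "?i < n" "?j < n" using n by (auto simp: nat_less_iff)
  have d: "j mod int n = i mod int n \<Longrightarrow> int n dvd j - i" for i
    by (simp add: mod_eq_dvd_iff)
  have nd: "\<not> int n dvd x" if "0 < x" "x < int n" for x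
    using that zdvd_not_zless by blast
  have ne: "j mod int n \<noteq> k mod int n" "j mod int n \<noteq> (k + 1) mod int n"
    using d[of k] d[of "k+1"] nd[of "j - k"] nd[of "j - (k+1)"] assms by auto
  have "?j \<noteq> ?i" "?j \<noteq> Suc ?i mod n"
    using ne n nat_Suc_mod[of n k] by (auto simp: eq_nat_nat_iff)
  then have "cross (v (Suc ?i mod n) - v ?i) (v ?j - v ?i) < 0"
    using assms(1) \<open>?i < n\<close> \<open>?j < n\<close> by (simp add: cw_convex_polygon_def)
  then show ?thesis using nat_Suc_mod[of n k] n by (simp add: side_def vtx_def)
qed

lemma cross_side_nonpos:
  assumes "cw_convex_polygon v n"
  shows "cross (side v n k) (vtx v n j - vtx v n k) \<le> 0"
proof -
  have n: "n \<ge> 3" using assms by (simp add: cw_convex_polygon_def)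
  \<comment> \<open>The representative of \<open>j\<close> modulo \<open>n\<close> in the window
    from \<open>k\<close> to \<open>k + n - 1\<close>.\<close>
  define j' where "j' = k + (j - k) mod int n"
  have "j' mod int n = j mod int n" unfolding j'_def by (simp add: mod_add_right_eq)
  then have eq: "vtx v n j = vtx v n j'" by (metis vtx_mod_eq)
  have "0 \<le> (j - k) mod int n" "(j - k) mod int n < int n" using n by auto
  then have "j' = k \<or> j' = k + 1 \<or> (k + 1 < j' \<and> j' < k + int n)" unfolding j'_def by linarith
  then show ?thesis
    using cross_side_neg[OF assms, of k j'] eq
    by (auto simp: cross_simps(9,11) simp flip: side_def)
qed

lemma side_nonzero:
  assumes "cw_convex_polygon v n"
  shows "side v n k \<noteq> 0"
proof
  have n: "n \<ge> 3" using assms by (simp add: cw_convex_polygon_def)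
  assume "side v n k = 0"
  then show False using cross_side_neg[OF assms, of k "k + 2"] n by (simp add: cross_simps)
qed

text \<open>Seen from vertex \<open>k\<close>, consecutive vertices turn clockwise, because vertex
  \<open>k + n\<close>, the same point, lies to the right of every side not touching it. No vertex
  lies to the left of the first side, so \<open>cross_trans\<close> passes from neighbours to
  arbitrary pairs by induction on \<open>m\<close>.\<close>

lemma orient_vtx_neg:
  assumes cw: "cw_convex_polygon v n" and "k < l" "l < m" "m < k + int n"
  shows "orient (vtx v n k) (vtx v n l) (vtx v n m) < 0"
proof -
  let ?w = "\<lambda>j. vtx v n j - vtx v n k"
  have step: "cross (?w j) (?w (j + 1)) < 0" if "k < j" "j + 1 < k + int n" for j
    using cross_side_neg[OF cw, of j "k + int n"] that
    by (simp add: side_def vtx_shift cross_def algebra_simps)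
  have base: "cross (?w (k + 1)) (?w j) < 0" if "k + 1 < j" "j < k + int n" for j
    using cross_side_neg[OF cw that] by (simp add: side_def)
  have "m < k + int n \<longrightarrow> cross (?w l) (?w m) < 0"
    using \<open>l < m\<close>
  proof (induction m rule: int_gr_induct)
    case base
    then show ?case using step[of l] assms by simp
  next
    case (step m)
    show ?case
    proof
      assume m: "m + 1 < k + int n"
      have "cross (?w (k + 1)) (?w l) \<le> 0"
      proof (cases "l = k + 1")
        case True then show ?thesis by (simp add: cross_simps)
      next
        case False then show ?thesis using base[of l] assms step m by (auto intro: less_imp_le)
      qed
      then show "cross (?w l) (?w (m + 1)) < 0"
        using cross_trans[of "?w (k + 1)" "?w l" "?w m" "?w (m + 1)"] base[of m] base[of "m + 1"]
          \<open>\<And>j. k < j \<Longrightarrow> j + 1 < k + int n \<Longrightarrow> cross (?w j) (?w (j + 1)) < 0\<close>[of m] step m assms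
        by auto
    qed
  qed
  then show ?thesis using assms by (simp add: orient_def)
qed

lemma orient_vtx_nonpos:
  assumes cw: "cw_convex_polygon v n" and "k \<le> l" "l \<le> m" "m \<le> k + int n"
  shows "orient (vtx v n k) (vtx v n l) (vtx v n m) \<le> 0"
proof (cases "k = l \<or> l = m \<or> m = k + int n")
  case True
  then show ?thesis by (auto simp: orient_refl vtx_shift)
next
  case False
  then show ?thesis using orient_vtx_neg[OF cw, of k l m] assms by auto
qed

section \<open>Orientation of three boundary points\<close>

lemma bpar_same_side_diff:
  assumes "n > 0" "of_int k \<le> s" "s \<le> of_int k + 1" "of_int k \<le> t" "t \<le> of_int k + 1"
  shows "bpar v n t - bpar v n s = (t - s) *\<^sub>R side v n k"
  using assms by (simp add: bpar_on_side[of n k] algebra_simps)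

lemma orient_same_side:
  assumes "n > 0" "{s, t, u} \<subseteq> {of_int k..of_int k + 1}"
  shows "orient (bpar v n s) (bpar v n t) (bpar v n u) = 0"
  using assms by (simp add: orient_def bpar_same_side_diff[of n k] cross_simps)

text \<open>The boundary arc from \<open>bpar v n s\<close> clockwise to \<open>bpar v n t\<close> stays on one closed edge.\<close>

definition one_side :: "real \<Rightarrow> real \<Rightarrow> bool" where
  "one_side s t \<longleftrightarrow> (\<exists>k::int. of_int k \<le> s \<and> t \<le> of_int k + 1)"

lemma one_side_mono: "one_side s t \<Longrightarrow> s \<le> s' \<Longrightarrow> t' \<le> t \<Longrightarrow> one_side s' t'"
  unfolding one_side_def by (meson order_trans)

lemma one_side_shift: "one_side (s + real n) (t + real n) \<longleftrightarrow> one_side s t"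
proof
  assume "one_side (s + real n) (t + real n)"
  then obtain k :: int where "of_int k \<le> s + real n" "t + real n \<le> of_int k + 1"
    by (auto simp: one_side_def)
  then show "one_side s t" unfolding one_side_def by (intro exI[of _ "k - int n"]) simp
next
  assume "one_side s t"
  then obtain k :: int where "of_int k \<le> s" "t \<le> of_int k + 1"
    by (auto simp: one_side_def)
  then show "one_side (s + real n) (t + real n)"
    unfolding one_side_def by (intro exI[of _ "k + int n"]) simp
qed

lemma orient_zero_one_side:
  assumes "n > 0" "one_side s u" "s \<le> t" "t \<le> u"
  shows "orient (bpar v n s) (bpar v n t) (bpar v n u) = 0"
  using assms unfolding one_side_def by (auto intro!: orient_same_side)

text \<open>Both \<open>s\<close> and \<open>t\<close> lie on side \<open>k\<close>, so the
  orientation is \<open>t - s\<close> times the scaled height of the third point over that side. It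
  vanishes only if the third point is on side \<open>k\<close> too, in this turn or the
  next.\<close>

lemma orient_neg_same_floor:
  assumes cw: "cw_convex_polygon v n" and "s < t" "t < u" "u < s + real n" "\<lfloor>s\<rfloor> = \<lfloor>t\<rfloor>"
  shows "orient (bpar v n s) (bpar v n t) (bpar v n u) < 0 \<or> one_side s u \<or> one_side u (t + real n)"
proof -
  have n: "n \<ge> 3" using cw by (simp add: cw_convex_polygon_def)
  define k m where "k = \<lfloor>s\<rfloor>" and "m = \<lfloor>u\<rfloor>"
  have k: "of_int k \<le> s" "s < of_int k + 1" "of_int k \<le> t" "t < of_int k + 1"
    and m: "of_int m \<le> u" "u < of_int m + 1"
    using assms unfolding k_def m_def by linarith+
  have "k \<le> m" "m \<le> k + int n" using assms unfolding k_def m_def by linarith+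
  let ?g = "bpar v n" and ?V = "vtx v n" and ?e = "side v n k"
  have eq: "orient (?g s) (?g t) (?g u) = (t - s) * cross ?e (?g u - ?V k)"
  proof -
    have "?g t - ?g s = (t - s) *\<^sub>R ?e" using n k by (intro bpar_same_side_diff) auto
    moreover have "?g u - ?g s = (?g u - ?V k) - (s - of_int k) *\<^sub>R ?e"
      using n k by (simp add: bpar_on_side[of n k s])
    ultimately have "orient (?g s) (?g t) (?g u)
        = cross ((t - s) *\<^sub>R ?e) ((?g u - ?V k) - (s - of_int k) *\<^sub>R ?e)"
      by (simp only: orient_def)
    then show ?thesis by (simp only: cross_simps) (simp add: algebra_simps)
  qed
  have u: "cross ?e (?g u - ?V k) = (1 - (u - m)) * cross ?e (?V m - ?V k) + (u - m) * cross ?e (?V (m + 1) - ?V k)"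
    using n m by (subst bpar_convex_comb[of n m]) (auto simp: cross_def algebra_simps)
  have w: "1 - (u - m) > 0" "u - m \<ge> 0" using m by auto
  have np: "cross ?e (?V (m + 1) - ?V k) \<le> 0" "cross ?e (?V m - ?V k) \<le> 0"
    using cross_side_nonpos[OF cw] by auto
  \<comment> \<open>The third point is on side \<open>k\<close>, on its copy one turn later, at its
    end vertex, further along side \<open>k + 1\<close>, or beyond. In the last two cases an
    endpoint of its side with positive weight lies strictly to the right of side
    \<open>k\<close>.\<close>
  consider "m = k" | "m = k + int n" | "m = k + 1" "u = of_int m" | "m = k + 1" "u > of_int m"
    | "k + 1 < m" "m < k + int n"
    using \<open>k \<le> m\<close> \<open>m \<le> k + int n\<close> m by force
  then show ?thesis
  proof cases
    case 1
    then show ?thesis using k m by (auto simp: one_side_def intro!: exI[of _ k])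
  next
    case 2
    then show ?thesis using k m by (auto simp: one_side_def intro!: exI[of _ m])
  next
    case 3
    then show ?thesis using k m by (auto simp: one_side_def intro!: exI[of _ k])
  next
    case 4
    have "cross ?e (?V (m + 1) - ?V k) < 0"
      using cross_side_neg[OF cw, of k "m + 1"] 4 n by auto
    then have "(u - m) * cross ?e (?V (m + 1) - ?V k) < 0" using 4 by (simp add: mult_pos_neg)
    moreover have "(1 - (u - m)) * cross ?e (?V m - ?V k) \<le> 0"
      using w np by (simp add: mult_nonneg_nonpos)
    ultimately show ?thesis using eq u \<open>s < t\<close> by (simp add: mult_pos_neg)
  next
    case 5
    have "cross ?e (?V m - ?V k) < 0"
      using cross_side_neg[OF cw, of k m] 5 by auto
    then have "(1 - (u - m)) * cross ?e (?V m - ?V k) < 0" using w mult_pos_neg by blast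
    moreover have "(u - m) * cross ?e (?V (m + 1) - ?V k) \<le> 0"
      using w np by (simp add: mult_nonneg_nonpos)
    ultimately show ?thesis using eq u \<open>s < t\<close> by (simp add: mult_pos_neg)
  qed
qed

text \<open>Orientation is affine in each argument. Expanding the points over the endpoints of their
  sides leaves nonpositive vertex triangles only, and the triangle of the three starting vertices is
  negative and has positive weight.\<close>

lemma orient_neg_distinct_floors:
  assumes cw: "cw_convex_polygon v n" and
    lt: "\<lfloor>s\<rfloor> < \<lfloor>t\<rfloor>" "\<lfloor>t\<rfloor> < \<lfloor>u\<rfloor>" "\<lfloor>u\<rfloor> < \<lfloor>s\<rfloor> + int n"
  shows "orient (bpar v n s) (bpar v n t) (bpar v n u) < 0"
proof -
  have n: "n > 0" using cw by (simp add: cw_convex_polygon_def)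
  let ?g = "bpar v n" and ?V = "vtx v n"
  have comb: "(1 - x) * a + x * b \<le> 0" if "0 \<le> x" "x < 1" "a \<le> 0" "b \<le> 0" for x a b :: real
    using that by (smt (verit) mult_nonneg_nonpos)
  have comb': "(1 - x) * a + x * b < 0" if "0 \<le> x" "x < 1" "a < 0" "b \<le> 0" for x a b :: real
    using that by (smt (verit) mult_nonneg_nonpos mult_pos_neg)
  have fr: "?g x = (1 - frac x) *\<^sub>R ?V \<lfloor>x\<rfloor> + frac x *\<^sub>R ?V (\<lfloor>x\<rfloor> + 1)" for x
    by (simp add: bpar_eq_floor[OF n] side_def algebra_simps)
  have aff: "orient p q (?g x) = (1 - frac x) * orient p q (?V \<lfloor>x\<rfloor>) + frac x * orient p q (?V (\<lfloor>x\<rfloor> + 1))"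
    for p q x by (simp only: fr orient_affine)
  have le0: "orient (?V i) (?V j) (?g u) \<le> 0"
    if "i = \<lfloor>s\<rfloor> \<or> i = \<lfloor>s\<rfloor> + 1" "j = \<lfloor>t\<rfloor> \<or> j = \<lfloor>t\<rfloor> + 1" for i j
    unfolding aff using that lt
    by (intro comb orient_vtx_nonpos[OF cw]) (auto simp: frac_lt_1)
  have lt0: "orient (?V \<lfloor>s\<rfloor>) (?V \<lfloor>t\<rfloor>) (?g u) < 0"
    unfolding aff using lt
    by (intro comb' orient_vtx_nonpos[OF cw] orient_vtx_neg[OF cw]) (auto simp: frac_lt_1)
  have le1: "orient (?g u) (?V i) (?g t) \<le> 0"
    if "i = \<lfloor>s\<rfloor> \<or> i = \<lfloor>s\<rfloor> + 1" for i
    unfolding aff using le0[OF that]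
    by (intro comb) (auto simp: frac_lt_1 orient_rotate[of "?V i" _ "?g u", symmetric])
  have lt1: "orient (?g u) (?V \<lfloor>s\<rfloor>) (?g t) < 0"
    unfolding aff using le0 lt0
    by (intro comb') (auto simp: frac_lt_1 orient_rotate[of "?V \<lfloor>s\<rfloor>" _ "?g u", symmetric])
  have "orient (?g t) (?g u) (?g s) < 0"
    unfolding aff using le1 lt1
    by (intro comb') (auto simp: frac_lt_1 orient_rotate[of "?g u" _ "?g t", symmetric])
  then show ?thesis using orient_rotate[of "?g t" "?g u" "?g s"] by simp
qed

text \<open>The exceptions are the three ways of having all points on one closed side, according to
  which comes first on it.\<close>

lemma orient_neg_or_one_side:
  assumes cw: "cw_convex_polygon v n" and "s < t" "t < u" "u < s + real n"
  shows "orient (bpar v n s) (bpar v n t) (bpar v n u) < 0 \<or>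
    one_side s u \<or> one_side t (s + real n) \<or> one_side u (t + real n)"
proof -
  have n: "n > 0" using cw by (simp add: cw_convex_polygon_def)
  have fl: "\<lfloor>s + real n\<rfloor> = \<lfloor>s\<rfloor> + int n" by linarith
  have "\<lfloor>s\<rfloor> \<le> \<lfloor>t\<rfloor>" "\<lfloor>t\<rfloor> \<le> \<lfloor>u\<rfloor>" "\<lfloor>u\<rfloor> \<le> \<lfloor>s\<rfloor> + int n"
    using assms by linarith+
  then consider "\<lfloor>s\<rfloor> < \<lfloor>t\<rfloor>" "\<lfloor>t\<rfloor> < \<lfloor>u\<rfloor>" "\<lfloor>u\<rfloor> < \<lfloor>s\<rfloor> + int n" | "\<lfloor>s\<rfloor> = \<lfloor>t\<rfloor>"
    | "\<lfloor>t\<rfloor> = \<lfloor>u\<rfloor>" | "\<lfloor>u\<rfloor> = \<lfloor>s + real n\<rfloor>"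
    using fl by linarith
  then show ?thesis
  proof cases
    case 1
    then show ?thesis using orient_neg_distinct_floors[OF cw] by blast
  next
    case 2
    then show ?thesis using orient_neg_same_floor[OF cw, of s t u] assms by blast
  next
    case 3
    then show ?thesis using orient_neg_same_floor[OF cw, of t u "s + real n"] assms
        orient_rotate[of "bpar v n t" "bpar v n u" "bpar v n s"]
      by (auto simp: bpar_shift[OF n] one_side_shift)
  next
    case 4
    then show ?thesis using orient_neg_same_floor[OF cw, of u "s + real n" "t + real n"] assms
        orient_rotate[of "bpar v n s" "bpar v n t" "bpar v n u"]
        one_side_shift[of t n "s + real n"]
      by (auto simp: bpar_shift[OF n] one_side_shift)
  qed
qed

lemma orient_nonpos:
  assumes cw: "cw_convex_polygon v n" and "s \<le> t" "t \<le> u" "u \<le> s + real n"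
  shows "orient (bpar v n s) (bpar v n t) (bpar v n u) \<le> 0"
proof (cases "s = t \<or> t = u \<or> u = s + real n")
  case True
  have "n > 0" using cw by (simp add: cw_convex_polygon_def)
  then show ?thesis using True by (auto simp: orient_refl bpar_shift)
next
  case False
  have n: "n > 0" using cw by (simp add: cw_convex_polygon_def)
  have "one_side s u \<Longrightarrow> ?thesis"
    using orient_zero_one_side[OF n, of s u t] assms by simp
  moreover have "one_side t (s + real n) \<Longrightarrow> ?thesis"
    using orient_zero_one_side[OF n, of t "s + real n" u v] assms
      orient_rotate[of "bpar v n t" "bpar v n u" "bpar v n s"]
    by (simp add: bpar_shift[OF n])
  moreover have "one_side u (t + real n) \<Longrightarrow> ?thesis"
    using orient_zero_one_side[OF n, of u "t + real n" "s + real n" v] assms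
      orient_rotate[of "bpar v n s" "bpar v n t" "bpar v n u"]
    by (simp add: bpar_shift[OF n])
  ultimately show ?thesis using orient_neg_or_one_side[OF cw, of s t u] assms False by linarith
qed

subsection \<open>First-order stationary parallelograms\<close>

text \<open>\<open>cross (q - r) (s - r)\<close> is the area, signed so as to be positive for clockwise corners; the
  left-hand side of the last inequality is its derivative at \<open>p, q, r, s\<close> in direction
  \<open>x, y, z, w\<close>.\<close>

definition stationary :: "pt set \<Rightarrow> pt \<Rightarrow> pt \<Rightarrow> pt \<Rightarrow> pt \<Rightarrow> bool" where
  "stationary K p q r s \<longleftrightarrow> {p, q, r, s} \<subseteq> K \<and> p + r = q + s \<and> cross (q - r) (s - r) > 0 \<and>
     (\<forall>x\<in>K. \<forall>y\<in>K. \<forall>z\<in>K. \<forall>w\<in>K. x + z = y + w \<longrightarrow>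
        cross (q - r) (w - z) + cross (y - z) (s - r) \<le> 2 * cross (q - r) (s - r))"

lemma stationary_rotate:
  assumes "stationary K p q r s"
  shows "stationary K q r s p"
proof -
  have mem: "{p, q, r, s} \<subseteq> K" and par: "p + r = q + s" and pos: "cross (q - r) (s - r) > 0"
    and le: "\<And>x y z w. x \<in> K \<Longrightarrow> y \<in> K \<Longrightarrow> z \<in> K \<Longrightarrow> w \<in> K \<Longrightarrow> x + z = y + w \<Longrightarrow>
        cross (q - r) (w - z) + cross (y - z) (s - r) \<le> 2 * cross (q - r) (s - r)"
    using assms by (auto simp: stationary_def)
  have p: "p - s = q - r" "r - s = - (s - r)" using par by (auto simp: algebra_simps)
  have "cross (r - s) (w - z) + cross (y - z) (p - s) \<le> 2 * cross (r - s) (p - s)"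
    if m: "x \<in> K" "y \<in> K" "z \<in> K" "w \<in> K" and e: "x + z = y + w" for x y z w
  proof -
    have "w - z = x - y" using e by (simp add: algebra_simps)
    \<comment> \<open>The comparison parallelogram is relabelled as \<open>w, x, y, z\<close> to
      match the old starting corner.\<close>
    moreover have "cross (q - r) (z - y) + cross (x - y) (s - r) \<le> 2 * cross (q - r) (s - r)"
      using le[of w x y z] m e by (simp add: algebra_simps)
    ultimately show ?thesis unfolding p
      using cross_commute[of "s - r" "q - r"] cross_commute[of "s - r" "x - y"]
        cross_commute[of "y - z" "q - r"] by (simp add: cross_simps)
  qed
  moreover have "cross (r - s) (p - s) > 0"
    unfolding p using pos cross_commute[of "s - r" "q - r"] by (simp add: cross_simps)
  ultimately show ?thesis
    using mem par by (auto simp: stationary_def algebra_simps)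
qed

lemma convex_move:
  fixes a b :: "'a::real_vector"
  assumes "convex K" "a \<in> K" "b \<in> K" "0 \<le> x" "x \<le> 1"
  shows "a + x *\<^sub>R (b - a) \<in> K"
proof -
  have "(1 - x) *\<^sub>R a + x *\<^sub>R b \<in> K" using assms convexD_alt by blast
  then show ?thesis by (simp add: algebra_simps)
qed

lemma convex_move2:
  fixes a b c :: "'a::real_vector"
  assumes "convex K" "a \<in> K" "b \<in> K" "c \<in> K" "0 \<le> x" "0 \<le> y" "x + y \<le> 1"
  shows "a + x *\<^sub>R (b - a) + y *\<^sub>R (c - a) \<in> K"
proof (cases "x + y = 0")
  case True
  then show ?thesis using assms by (simp add: add_nonneg_eq_0_iff)
next
  case False
  let ?w = "b + (y / (x + y)) *\<^sub>R (c - b)"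
  have "?w \<in> K" using assms False by (intro convex_move) auto
  then have "a + (x + y) *\<^sub>R (?w - a) \<in> K" using assms by (intro convex_move[of K a ?w]) auto
  moreover have "(x + y) *\<^sub>R (?w - a) = x *\<^sub>R (b - a) + y *\<^sub>R (c - a)"
  proof -
    have "(x + y) *\<^sub>R (?w - a) = (x + y) *\<^sub>R (b - a) + y *\<^sub>R (c - b)"
      using False by (simp add: scaleR_add_right scaleR_diff_right)
    then show ?thesis by (simp add: algebra_simps)
  qed
  ultimately show ?thesis by (simp add: add.assoc)
qed

text \<open>The comparison parallelogram is \<open>p + d, q + d, r, s\<close>. The corners run
  clockwise, so \<open>cross (q - p) d > 0\<close> would move the side \<open>p q\<close> outwards
  and enlarge the area.\<close>

lemma stationary_no_outward_shift:
  assumes st: "stationary K p q r s" and "p + d \<in> K" "q + d \<in> K"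
  shows "cross (q - p) d \<le> 0"
proof -
  have m: "{p, q, r, s} \<subseteq> K" and par: "p + r = q + s" using st by (auto simp: stationary_def)
  have "cross (q - r) (s - r) + cross (q + d - r) (s - r) \<le> 2 * cross (q - r) (s - r)"
  proof -
    have "p + d + r = q + d + s" using par by (metis add.assoc add.commute)
    then show ?thesis using st assms m unfolding stationary_def by blast
  qed
  then have "cross d (s - r) \<le> 0" by (simp add: cross_simps)
  moreover have "s - r = - (q - p)" using par by (simp add: algebra_simps)
  ultimately show ?thesis
    using cross_commute[of d "q - p"] by (simp only: cross_simps)
qed

text \<open>From a relative interior point \<open>p\<close> the set extends beyond \<open>p\<close>
  on the lines from \<open>q\<close> and from \<open>s\<close>, which leaves room to translate the
  side \<open>p q\<close> outwards.\<close>

lemma stationary_not_rel_interior: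
  assumes K: "convex K" and st: "stationary K p q r s"
  shows "p \<notin> rel_interior K"
proof
  assume "p \<in> rel_interior K"
  have m: "p \<in> K" "q \<in> K" "s \<in> K" and par: "p + r = q + s"
    and pos: "cross (q - r) (s - r) > 0" using st by (auto simp: stationary_def)
  have ext: "\<exists>e>0. p + e *\<^sub>R (p - x) \<in> K" if x: "x \<in> K" for x
  proof -
    obtain e where "e > 1" "(1 - e) *\<^sub>R x + e *\<^sub>R p \<in> K"
      using \<open>p \<in> rel_interior K\<close> convex_rel_interior_iff[OF K, of p] x m by auto
    then have "p + (e - 1) *\<^sub>R (p - x) \<in> K" by (simp add: algebra_simps)
    then show ?thesis using \<open>e > 1\<close> by (intro exI[of _ "e - 1"]) auto
  qed
  obtain e1 where e1: "e1 > 0" "p + e1 *\<^sub>R (p - q) \<in> K" using ext m by blast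
  obtain e3 where e3: "e3 > 0" "p + e3 *\<^sub>R (p - s) \<in> K" using ext m by blast
  \<comment> \<open>Chosen so that \<open>p + d\<close> is the combination of
    \<open>p + e3 *\<^sub>R (p - s)\<close> and \<open>p + e1 *\<^sub>R (p - q)\<close> with weights
    \<open>t\<close> and \<open>t / e1\<close>, which add up to 1.\<close>
  define t where "t = e1 / (1 + e1)"
  have t: "0 < t" "t \<le> 1" "t + t / e1 = 1"
    using e1 by (auto simp: t_def divide_simps)
  define d where "d = t *\<^sub>R ((p + e3 *\<^sub>R (p - s)) - q)"
  have "q + d \<in> K" unfolding d_def using t e3 m by (intro convex_move[OF K]) auto
  moreover have "p + d \<in> K"
  proof -
    have "p + t *\<^sub>R ((p + e3 *\<^sub>R (p - s)) - p) + (t / e1) *\<^sub>R ((p + e1 *\<^sub>R (p - q)) - p) \<in> K"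
      using t e1 e3 m by (intro convex_move2[OF K]) auto
    then show ?thesis using e1 by (simp add: d_def algebra_simps)
  qed
  ultimately have "cross (q - p) d \<le> 0" using stationary_no_outward_shift[OF st] by blast
  moreover have "cross (q - p) d = t * e3 * cross (q - p) (p - s)"
    unfolding d_def by (simp add: cross_def algebra_simps)
  moreover have "p - s = q - r" "q - p = - (s - r)" using par by (auto simp: algebra_simps)
  ultimately have "t * e3 * - cross (s - r) (q - r) \<le> 0"
    by (simp only: cross_simps(7,8))
  then have "t * e3 * cross (q - r) (s - r) \<le> 0"
    using cross_commute[of "s - r" "q - r"] by simp
  then show False using t e3 pos by (simp add: mult_le_0_iff)
qed

text \<open>The area is a quadratic form; the sum of the first-order inequalities of each
  parallelogram towards the other bounds the mixed terms of its value at the difference.\<close>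

lemma stationary_diff_nonneg:
  assumes A: "stationary K a0 a1 a2 a3" and B: "stationary K b0 b1 b2 b3"
  shows "0 \<le> cross ((b1 - b2) - (a1 - a2)) ((b3 - b2) - (a3 - a2))"
proof -
  have "cross (a1 - a2) (b3 - b2) + cross (b1 - b2) (a3 - a2) \<le> 2 * cross (a1 - a2) (a3 - a2)"
    using A B unfolding stationary_def by auto
  moreover have "cross (b1 - b2) (a3 - a2) + cross (a1 - a2) (b3 - b2) \<le> 2 * cross (b1 - b2) (b3 - b2)"
    using A B unfolding stationary_def by auto
  moreover have "cross ((b1 - b2) - (a1 - a2)) ((b3 - b2) - (a3 - a2)) =
     cross (b1 - b2) (b3 - b2) - cross (a1 - a2) (b3 - b2) - cross (b1 - b2) (a3 - a2) + cross (a1 - a2) (a3 - a2)"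
    by (simp only: cross_simps)
  ultimately show ?thesis by linarith
qed

text \<open>Corners 0, 1, 3 move with speeds \<open>x0\<close>, \<open>x1\<close>, \<open>x3\<close>
  while corner 2 stays; \<open>bal\<close> says that the result remains a parallelogram. The
  conclusion bounds the derivative of the area along this move.\<close>

lemma stationary_three_moves:
  assumes K: "convex K" and A: "stationary K a0 a1 a2 a3" and "b0 \<in> K" "b1 \<in> K" "b3 \<in> K"
    and nn: "0 \<le> x0" "0 \<le> x1" "0 \<le> x3"
    and bal: "x0 *\<^sub>R (b0 - a0) = x1 *\<^sub>R (b1 - a1) + x3 *\<^sub>R (b3 - a3)"
  shows "x3 * cross (a1 - a2) (b3 - a3) + x1 * cross (b1 - a1) (a3 - a2) \<le> 0"
proof -
  \<comment> \<open>Scales the speeds to fractions of at most 1, so that convexity keeps the corners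
    in \<open>K\<close>.\<close>
  define t where "t = 1 / (1 + x0 + x1 + x3)"
  have t: "t > 0" "t * x0 \<le> 1" "t * x1 \<le> 1" "t * x3 \<le> 1"
    using nn by (auto simp: t_def field_simps)
  have m: "a0 \<in> K" "a1 \<in> K" "a2 \<in> K" "a3 \<in> K" and par: "a0 + a2 = a1 + a3"
    and le: "\<And>x y z w. x \<in> K \<Longrightarrow> y \<in> K \<Longrightarrow> z \<in> K \<Longrightarrow> w \<in> K \<Longrightarrow> x + z = y + w \<Longrightarrow>
        cross (a1 - a2) (w - z) + cross (y - z) (a3 - a2) \<le> 2 * cross (a1 - a2) (a3 - a2)"
    using A by (auto simp: stationary_def)
  let ?m = "\<lambda>a x b. a + (t * x) *\<^sub>R (b - a)"
  have eq: "?m a0 x0 b0 + a2 = ?m a1 x1 b1 + ?m a3 x3 b3"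
  proof -
    have "(t * x0) *\<^sub>R (b0 - a0) = (t * x1) *\<^sub>R (b1 - a1) + (t * x3) *\<^sub>R (b3 - a3)"
      using arg_cong[OF bal, of "\<lambda>y. t *\<^sub>R y"] by (simp add: scaleR_add_right)
    then show ?thesis using par by (simp add: algebra_simps)
  qed
  have "cross (a1 - a2) (?m a3 x3 b3 - a2) + cross (?m a1 x1 b1 - a2) (a3 - a2) \<le> 2 * cross (a1 - a2) (a3 - a2)"
    using t nn m assms by (intro le[OF _ _ _ _ eq] convex_move[OF K]) auto
  moreover have "cross (a1 - a2) (?m a3 x3 b3 - a2) + cross (?m a1 x1 b1 - a2) (a3 - a2)
     = 2 * cross (a1 - a2) (a3 - a2) + t * (x3 * cross (a1 - a2) (b3 - a3) + x1 * cross (b1 - a1) (a3 - a2))"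
    by (simp add: cross_def algebra_simps)
  ultimately show ?thesis using t by (simp add: mult_le_0_iff)
qed

lemma stationary_pair_contradiction:
  assumes K: "convex K" and A: "stationary K a0 a1 a2 a3" and B: "stationary K b0 b1 b2 b3"
    and V1: "a1 = b1 \<or> cross (a0 - b0) (b1 - a1) < 0"
    and V3: "a3 = b3 \<or> cross (b3 - a3) (a0 - b0) < 0"
    and ne: "a1 \<noteq> b1 \<or> a3 \<noteq> b3"
  shows False
proof -
  have m: "{a0, a1, a3, b0, b1, b3} \<subseteq> K" and par: "a0 + a2 = a1 + a3" "b0 + b2 = b1 + b3"
    using A B by (auto simp: stationary_def)
  define V0 V1 V3 where "V0 = a0 - b0" and "V1 = b1 - a1" and "V3 = b3 - a3"
  have d: "(b1 - b2) - (a1 - a2) = - (V0 + V3)" "(b3 - b2) - (a3 - a2) = - (V0 + V1)"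
    using par by (auto simp: V0_def V1_def V3_def algebra_simps)
  have sum: "0 \<le> cross V0 V1 + cross V3 V0 + cross V3 V1"
    using stationary_diff_nonneg[OF A B] unfolding d by (simp add: cross_simps)
  have z: "V1 = 0 \<or> cross V0 V1 < 0" "V3 = 0 \<or> cross V3 V0 < 0" "V1 \<noteq> 0 \<or> V3 \<noteq> 0"
    using V1 V3 ne by (auto simp: V0_def V1_def V3_def)
  \<comment> \<open>If \<open>V1\<close> or \<open>V3\<close> were zero, or
    \<open>cross V3 V1\<close> nonpositive, all terms of \<open>sum\<close> would be nonpositive and
    one of them negative.\<close>
  then have neg: "cross V0 V1 < 0" "cross V3 V0 < 0" "cross V3 V1 > 0"
    using sum by (auto simp: cross_simps)
  \<comment> \<open>the coefficients of the linear relation between \<open>V0, V1, V3\<close>, here all positive\<close>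
  define x0 x1 x3 where "x0 = cross V3 V1" and "x1 = - cross V3 V0" and "x3 = - cross V0 V1"
  have bal: "x0 *\<^sub>R V0 + x1 *\<^sub>R V1 + x3 *\<^sub>R V3 = 0"
    using cross_pluecker_vec[of V0 V1 V3] cross_commute[of V1 V3]
    by (simp add: x0_def x1_def x3_def algebra_simps)
  have nn: "0 \<le> x0" "0 \<le> x1" "0 \<le> x3" using neg by (auto simp: x0_def x1_def x3_def)
  have "x3 * cross (a1 - a2) V3 + x1 * cross V1 (a3 - a2) \<le> 0"
    unfolding V1_def V3_def
    using m nn bal
    by (intro stationary_three_moves[OF K A, of b0 b1 b3 x0])
       (auto simp: V0_def V1_def V3_def algebra_simps)
  \<comment> \<open>The same coefficients serve for the move in the other direction, as all
    difference vectors change sign.\<close>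
  moreover have "x3 * cross (b1 - b2) (a3 - b3) + x1 * cross (a1 - b1) (b3 - b2) \<le> 0"
    using m nn bal
    by (intro stationary_three_moves[OF K B, of a0 a1 a3 x0])
       (auto simp: V0_def V1_def V3_def algebra_simps)
  moreover have "a3 - b3 = - V3" "a1 - b1 = - V1" by (auto simp: V1_def V3_def)
  ultimately have "x3 * cross ((a1 - a2) - (b1 - b2)) V3 + x1 * cross V1 ((a3 - a2) - (b3 - b2)) \<le> 0"
    by (simp only: cross_simps) (simp add: algebra_simps)
  moreover have "(a1 - a2) - (b1 - b2) = V0 + V3" "(a3 - a2) - (b3 - b2) = V0 + V1"
    using d by (simp_all add: algebra_simps)
  ultimately have "x3 * cross V0 V3 + x1 * cross V1 V0 \<le> 0" by (simp add: cross_simps)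
  \<comment> \<open>Each of the two terms is the product of the negative numbers
    \<open>cross V0 V1\<close> and \<open>cross V3 V0\<close>.\<close>
  then have "2 * (cross V0 V1 * cross V3 V0) \<le> 0"
    using cross_commute[of V0 V3] cross_commute[of V1 V0] by (simp add: x1_def x3_def)
  then show False using neg by (simp add: mult_le_0_iff)
qed

text \<open>Here \<open>y\<close> and \<open>z\<close> lie beyond the side \<open>p q\<close>. If
  the rays from \<open>p\<close> through \<open>y\<close> and from \<open>q\<close> through
  \<open>z\<close> did not converge, that side could be translated outwards within \<open>K\<close>.
  The number \<open>R\<close> measures this failure.\<close>

lemma stationary_cap_converges:
  assumes K: "convex K" and st: "stationary K p q r s" and "y \<in> K" "z \<in> K"
    and pos: "cross (q - p) (y - p) > 0" "cross (q - p) (z - p) > 0"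
  shows "cross (y - p) (q - z) < 0"
proof (rule ccontr)
  assume "\<not> cross (y - p) (q - z) < 0"
  have m: "p \<in> K" "q \<in> K" using st by (auto simp: stationary_def)
  define u V W where "u = q - p" and "V = y - p" and "W = z - q"
  define P Q R where "P = cross u V" and "Q = cross u W" and "R = cross W V"
  have "P > 0" "Q > 0" "R \<ge> 0"
    using pos \<open>\<not> cross (y - p) (q - z) < 0\<close>
    by (auto simp: P_def Q_def R_def u_def V_def W_def cross_def algebra_simps)
  have eq: "P *\<^sub>R W = Q *\<^sub>R V + R *\<^sub>R u"
    using cross_pluecker_vec[of u W V] cross_commute[of V u]
    by (simp add: P_def Q_def R_def)
  define t where "t = 1 / (1 + P + Q + R)"
  have t: "t > 0" "t * P \<le> 1" "t * Q + t * R \<le> 1"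
    using \<open>P > 0\<close> \<open>Q > 0\<close> \<open>R \<ge> 0\<close> by (auto simp: t_def simp flip: add_divide_distrib)
  \<comment> \<open>by \<open>eq\<close> this translation moves \<open>q\<close> towards \<open>z\<close> and \<open>p\<close> into the triangle \<open>p y q\<close>\<close>
  define d where "d = (t * P) *\<^sub>R W"
  have "q + d \<in> K"
    unfolding d_def W_def using t \<open>P > 0\<close> m assms by (intro convex_move[OF K]) auto
  moreover have "p + d \<in> K"
  proof -
    have "d = (t * Q) *\<^sub>R V + (t * R) *\<^sub>R u"
      using arg_cong[OF eq, of "\<lambda>y. t *\<^sub>R y"] by (simp add: d_def scaleR_add_right)
    moreover have "p + (t * Q) *\<^sub>R V + (t * R) *\<^sub>R u \<in> K"
      unfolding V_def u_def using t \<open>Q > 0\<close> \<open>R \<ge> 0\<close> m assms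
      by (intro convex_move2[OF K]) auto
    ultimately show ?thesis by (simp add: add.assoc)
  qed
  ultimately have "cross u d \<le> 0" unfolding u_def using stationary_no_outward_shift[OF st] by blast
  then have "t * P * Q \<le> 0" by (simp add: d_def Q_def cross_simps)
  then show False using t \<open>P > 0\<close> \<open>Q > 0\<close> by (simp add: mult_le_0_iff)
qed

subsection \<open>Corners lie on the boundary\<close>

lemma cross_eq_0_imp_scaleR:
  assumes "cross e w = 0" "e \<noteq> 0"
  obtains x where "w = x *\<^sub>R e"
proof (cases "fst e = 0")
  case True
  then have "snd e \<noteq> 0" "fst w = 0" using assms by (auto simp: prod_eq_iff cross_def)
  then have "w = (snd w / snd e) *\<^sub>R e" using True by (simp add: prod_eq_iff)
  then show ?thesis by (rule that)
next
  case False
  then have "w = (fst w / fst e) *\<^sub>R e" using assms by (simp add: prod_eq_iff cross_def field_simps)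
  then show ?thesis by (rule that)
qed

lemma convex_polygon: "convex (polygon v n)"
  by (simp add: polygon_def)

lemma vtx_in_polygon: "n > 0 \<Longrightarrow> vtx v n k \<in> polygon v n"
  unfolding polygon_def vtx_def by (intro hull_inc) (auto simp: nat_less_iff)

lemma bpar_in_polygon:
  assumes "n > 0"
  shows "bpar v n t \<in> polygon v n"
proof -
  have "vtx v n \<lfloor>t\<rfloor> + frac t *\<^sub>R (vtx v n (\<lfloor>t\<rfloor> + 1) - vtx v n \<lfloor>t\<rfloor>) \<in> polygon v n"
    using assms by (intro convex_move convex_polygon vtx_in_polygon) (auto simp: frac_lt_1 less_imp_le)
  then show ?thesis by (simp add: bpar_eq_floor[OF assms] side_def)
qed

lemma polygon_halfplane:
  assumes cw: "cw_convex_polygon v n" and "x \<in> polygon v n"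
  shows "cross (side v n k) (x - vtx v n k) \<le> 0"
proof -
  let ?H = "{x. cross (side v n k) (x - vtx v n k) \<le> 0}"
  have "convex ?H"
  proof (rule convexI)
    fix x y :: pt and a b :: real
    assume *: "x \<in> ?H" "y \<in> ?H" "0 \<le> a" "0 \<le> b" "a + b = 1"
    have "a *\<^sub>R x + b *\<^sub>R y - vtx v n k = a *\<^sub>R (x - vtx v n k) + b *\<^sub>R (y - vtx v n k)"
      using scaleR_add_left[of a b "vtx v n k"] \<open>a + b = 1\<close> by (simp add: algebra_simps)
    then have "cross (side v n k) (a *\<^sub>R x + b *\<^sub>R y - vtx v n k) =
        a * cross (side v n k) (x - vtx v n k) + b * cross (side v n k) (y - vtx v n k)"
      by (simp only: cross_simps)
    then show "a *\<^sub>R x + b *\<^sub>R y \<in> ?H"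
      using * by (simp add: mult_nonneg_nonpos add_nonpos_nonpos)
  qed
  moreover have "v ` {..<n} \<subseteq> ?H"
  proof clarsimp
    fix i assume "i < n"
    then have "v i = vtx v n (int i)" by (simp add: vtx_def)
    then show "cross (side v n k) (v i - vtx v n k) \<le> 0" using cross_side_nonpos[OF cw] by simp
  qed
  ultimately have "polygon v n \<subseteq> ?H" unfolding polygon_def by (rule hull_minimal[rotated])
  then show ?thesis using assms by auto
qed

text \<open>The point is \<open>vtx v n k\<close> plus \<open>c\<close> times the side. The
  half-plane of the preceding side gives \<open>c \<ge> 0\<close>, that of the following side
  \<open>c \<le> 1\<close>.\<close>

lemma polygon_on_side_line:
  assumes cw: "cw_convex_polygon v n" and x: "x \<in> polygon v n"
    and 0: "cross (side v n k) (x - vtx v n k) = 0"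
  shows "x \<in> range (bpar v n)"
proof -
  have n: "n \<ge> 3" using cw by (simp add: cw_convex_polygon_def)
  let ?e = "side v n k"
  obtain c where c: "x - vtx v n k = c *\<^sub>R ?e"
    using cross_eq_0_imp_scaleR[OF 0 side_nonzero[OF cw]] by blast
  have "c \<ge> 0"
  proof -
    have "x - vtx v n (k - 1) = c *\<^sub>R ?e + side v n (k - 1)" using c by (simp add: side_def algebra_simps)
    then have "c * cross (side v n (k - 1)) ?e \<le> 0"
      using polygon_halfplane[OF cw x, of "k - 1"] by (simp add: cross_simps)
    moreover have "cross (side v n (k - 1)) ?e < 0"
    proof -
      have "vtx v n (k + 1) - vtx v n (k - 1) = ?e + side v n (k - 1)" by (simp add: side_def)
      then show ?thesis using cross_side_neg[OF cw, of "k - 1" "k + 1"] n by (simp add: cross_simps)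
    qed
    ultimately show ?thesis by (simp add: mult_le_0_iff)
  qed
  moreover have "c \<le> 1"
  proof -
    have "x - vtx v n (k + 1) = (c - 1) *\<^sub>R ?e" using c by (simp add: side_def algebra_simps)
    then have "(c - 1) * cross (side v n (k + 1)) ?e \<le> 0"
      using polygon_halfplane[OF cw x, of "k + 1"] by (simp add: cross_simps)
    moreover have "cross (side v n (k + 1)) ?e > 0"
    proof -
      have "vtx v n (k + int n) - vtx v n (k + 1) = - ?e" by (simp add: side_def vtx_shift)
      then show ?thesis using cross_side_neg[OF cw, of "k + 1" "k + int n"] n by (simp add: cross_simps)
    qed
    ultimately show ?thesis by (simp add: mult_le_0_iff)
  qed
  ultimately have "bpar v n (of_int k + c) = x"
    using n c by (subst bpar_on_side[of n k]) (auto simp: algebra_simps)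
  then show ?thesis by (metis rangeI)
qed

text \<open>A supporting functional \<open>a\<close> at \<open>x\<close> is minimal at some vertex
  too. From there, \<open>w\<close> is a nonnegative combination of the two edge vectors
  \<open>e\<close> and \<open>e'\<close>, on which \<open>a\<close> is nonnegative but not zero on
  both. As \<open>a\<close> vanishes on \<open>w\<close>, one coefficient is zero and
  \<open>x\<close> lies on the line of an edge.\<close>

lemma polygon_boundary:
  assumes cw: "cw_convex_polygon v n" and x: "x \<in> polygon v n" "x \<notin> rel_interior (polygon v n)"
  shows "x \<in> range (bpar v n)"
proof -
  have n: "n \<ge> 3" using cw by (simp add: cw_convex_polygon_def)
  obtain a where a: "a \<noteq> 0" "\<And>y. y \<in> polygon v n \<Longrightarrow> a \<bullet> x \<le> a \<bullet> y"
    using supporting_hyperplane_rel_boundary[OF convex_polygon x] by metis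
  have "\<exists>i<n. a \<bullet> v i \<le> a \<bullet> x"
  proof (rule ccontr)
    assume "\<not> (\<exists>i<n. a \<bullet> v i \<le> a \<bullet> x)"
    then have "v ` {..<n} \<subseteq> {y. a \<bullet> y > a \<bullet> x}" by auto
    then have "polygon v n \<subseteq> {y. a \<bullet> y > a \<bullet> x}"
      unfolding polygon_def by (rule hull_minimal) (rule convex_halfspace_gt)
    then show False using x by auto
  qed
  then obtain i where i: "i < n" "a \<bullet> v i \<le> a \<bullet> x" by blast
  define k where "k = int i"
  have vk: "vtx v n k = v i" using i by (simp add: k_def vtx_def)
  define e e' w where "e = side v n k" and "e' = vtx v n (k - 1) - vtx v n k" and "w = x - vtx v n k"
  have V: "vtx v n j \<in> polygon v n" for j using n by (simp add: vtx_in_polygon)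
  have aw: "a \<bullet> w = 0" using a(2)[OF V[of k]] i vk by (simp add: w_def inner_diff_right)
  have ae: "a \<bullet> e \<ge> 0" "a \<bullet> e' \<ge> 0"
    using a(2)[OF V] i vk by (auto simp: e_def e'_def side_def inner_diff_right intro: order_trans)
  have s: "side v n (k - 1) = - e'" "x - vtx v n (k - 1) = w - e'" by (auto simp: e'_def w_def side_def)
  have ew: "cross e' w \<ge> 0" "cross w e \<ge> 0"
    using polygon_halfplane[OF cw x(1), of k] polygon_halfplane[OF cw x(1), of "k - 1"]
      cross_commute[of w e]
    unfolding s by (auto simp: w_def e_def cross_simps)
  have ee: "cross e e' < 0"
    using cross_side_neg[OF cw, of k "k - 1 + int n"] n
    by (simp only: vtx_shift) (simp add: e_def e'_def)
  have "cross e e' *\<^sub>R w + cross e' w *\<^sub>R e + cross w e *\<^sub>R e' = 0"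
    by (rule cross_pluecker_vec)
  then have "a \<bullet> (cross e e' *\<^sub>R w + cross e' w *\<^sub>R e + cross w e *\<^sub>R e') = 0" by simp
  then have "cross e' w * (a \<bullet> e) + cross w e * (a \<bullet> e') = 0"
    using aw by (simp add: inner_add_right)
  then have z: "cross e' w * (a \<bullet> e) = 0" "cross w e * (a \<bullet> e') = 0"
    using ew ae by (simp_all add: add_nonneg_eq_0_iff)
  have "cross e' w = 0 \<or> cross w e = 0"
  proof (rule ccontr)
    assume "\<not> ?thesis"
    then have "a \<bullet> e = 0" "a \<bullet> e' = 0" using z by auto
    then have "fst a * fst e + snd a * snd e = 0" "fst a * fst e' + snd a * snd e' = 0"
      by (simp_all add: inner_prod_def)
    then have "cross e e' * fst a = 0" "cross e e' * snd a = 0"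
      unfolding cross_def by algebra+
    then show False using a(1) ee by (auto simp: prod_eq_iff)
  qed
  then show ?thesis
  proof
    assume "cross e' w = 0"
    then have "cross (side v n (k - 1)) (x - vtx v n (k - 1)) = 0"
      unfolding s by (simp add: cross_simps)
    then show ?thesis by (rule polygon_on_side_line[OF cw x(1)])
  next
    assume "cross w e = 0"
    then have "cross (side v n k) (x - vtx v n k) = 0"
      using cross_commute[of e w] by (simp add: e_def w_def)
    then show ?thesis by (rule polygon_on_side_line[OF cw x(1)])
  qed
qed

section \<open>From local maximality to the first-order condition\<close>

lemma locally_maximal_stationary:
  assumes lm: "locally_maximal v n A" and cp: "clockwise_par A"
  shows "stationary (polygon v n) (A 0) (A 1) (A 2) (A 3)"
proof -
  let ?K = "polygon v n"
  have par: "A 0 + A 2 = A 1 + A 3" and mem: "\<And>i. i < 4 \<Longrightarrow> A i \<in> ?K"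
    using lm by (auto simp: locally_maximal_def parallelogram_def lies_in_def)
  obtain \<delta> where "\<delta> > 0" and max: "\<And>B. parallelogram B \<Longrightarrow> lies_in B ?K \<Longrightarrow>
      (\<forall>i<4. dist (A i) (B i) < \<delta>) \<Longrightarrow> par_area B \<le> par_area A"
    using lm by (auto simp: locally_maximal_def)
  define F where "F = (\<lambda>B :: nat \<Rightarrow> pt. cross (B 1 - B 2) (B 3 - B 2))"
  have area: "par_area B = \<bar>F B\<bar>" if "parallelogram B" for B
  proof -
    have "B 1 - B 0 = - (B 3 - B 2)" "B 3 - B 0 = - (B 1 - B 2)"
      using that by (auto simp: parallelogram_def algebra_simps)
    then have "cross (B 1 - B 0) (B 3 - B 0) = cross (B 3 - B 2) (B 1 - B 2)"
      by (simp only: cross_simps)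
    then show ?thesis
      using cross_commute[of "B 1 - B 2" "B 3 - B 2"] by (simp add: par_area_def F_def)
  qed
  have pos: "F A > 0"
  proof -
    have "A 1 - A 0 = - (A 3 - A 2)" "A 2 - A 1 = - (A 1 - A 2)"
      using par by (simp_all add: algebra_simps)
    then have "cross (A 3 - A 2) (A 1 - A 2) < 0"
      using cp unfolding clockwise_par_def by (simp only: cross_simps)
    then show ?thesis using cross_commute[of "A 1 - A 2" "A 3 - A 2"] by (simp add: F_def)
  qed
  \<comment> \<open>On the segment from \<open>A\<close> towards \<open>X\<close> the area form is
    quadratic in \<open>t\<close> with slope \<open>c\<close> at 0; a positive slope would give
    larger parallelograms arbitrarily close to \<open>A\<close>.\<close>
  have "cross (A 1 - A 2) (X 3 - X 2) + cross (X 1 - X 2) (A 3 - A 2) \<le> 2 * F A"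
    if X: "parallelogram X" "lies_in X ?K" for X
  proof (rule ccontr)
    define c where "c = cross (A 1 - A 2) (X 3 - X 2) + cross (X 1 - X 2) (A 3 - A 2) - 2 * F A"
    define Q where "Q = F (\<lambda>i. X i - A i)"
    assume "\<not> ?thesis"
    then have "c > 0" by (simp add: c_def)
    define N where "N = (\<Sum>i<4. norm (X i - A i)) + 1"
    have N: "norm (X i - A i) < N" if "i < 4" for i
      using member_le_sum[of i "{..<4}" "\<lambda>i. norm (X i - A i)"] that by (simp add: N_def)
    have "N > 0" using N[of 0] by (smt (verit) norm_ge_zero zero_less_numeral)
    \<comment> \<open>The three bounds keep \<open>B\<close> inside the polygon, keep it closer than
      \<open>\<delta>\<close> to \<open>A\<close>, and make the quadratic term at most half of the
      linear one.\<close>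
    define t where "t = min 1 (min (\<delta> / N) (c / (2 * (\<bar>Q\<bar> + 1))))"
    have t: "0 < t" "t \<le> 1" "t \<le> \<delta> / N" "t \<le> c / (2 * (\<bar>Q\<bar> + 1))"
      using \<open>\<delta> > 0\<close> \<open>N > 0\<close> \<open>c > 0\<close> by (auto simp: t_def)
    define B where "B = (\<lambda>i. A i + t *\<^sub>R (X i - A i))"
    have pB: "parallelogram B"
    proof -
      have "X 0 + X 2 = X 1 + X 3" using X by (simp add: parallelogram_def)
      then have "t *\<^sub>R (X 0 - A 0) + t *\<^sub>R (X 2 - A 2) = t *\<^sub>R (X 1 - A 1) + t *\<^sub>R (X 3 - A 3)"
        using par by (simp add: algebra_simps flip: scaleR_add_right)
      then show ?thesis using par by (simp add: parallelogram_def B_def algebra_simps)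
    qed
    have "lies_in B ?K"
      using X mem t unfolding lies_in_def B_def
      by (auto intro!: convex_move convex_polygon)
    moreover have "dist (A i) (B i) < \<delta>" if "i < 4" for i
    proof -
      have "dist (A i) (B i) = t * norm (X i - A i)" using t by (simp add: B_def dist_norm)
      also have "\<dots> < t * N" using t N[OF that] by simp
      also have "\<dots> \<le> \<delta>" using t \<open>N > 0\<close> by (simp add: pos_le_divide_eq)
      finally show ?thesis .
    qed
    ultimately have "par_area B \<le> par_area A" using max pB by blast
    then have "F B \<le> F A" using area[OF pB] area[of A] pos par by (simp add: parallelogram_def)
    moreover have "F B = F A + t * (c + t * Q)"
      by (simp add: F_def B_def c_def Q_def cross_def algebra_simps)
    ultimately have "c + t * Q \<le> 0" using t by (simp add: mult_le_0_iff)
    moreover have "\<bar>t * Q\<bar> \<le> c / 2"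
    proof -
      have "\<bar>t * Q\<bar> \<le> t * (\<bar>Q\<bar> + 1)" using t by (simp add: abs_mult)
      also have "\<dots> \<le> c / 2" using t(4) by (simp add: field_simps)
      finally show ?thesis .
    qed
    ultimately show False using \<open>c > 0\<close> by linarith
  qed
  note first_order = this
  have "cross (A 1 - A 2) (w - z) + cross (y - z) (A 3 - A 2) \<le> 2 * F A"
    if "x \<in> ?K" "y \<in> ?K" "z \<in> ?K" "w \<in> ?K" "x + z = y + w" for x y z w
    using first_order[of "\<lambda>i. [x, y, z, w] ! i"] that
    by (auto simp: parallelogram_def lies_in_def less_Suc_eq numeral_eq_Suc)
  then show ?thesis
    using par pos mem by (auto simp: stationary_def F_def)
qed

subsection \<open>Relative position of two stationary parallelograms\<close>

text \<open>Parameter form of two corners in one open edge, the situation that non-slidability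
  excludes.\<close>

definition open_side :: "real \<Rightarrow> real \<Rightarrow> bool" where
  "open_side s t \<longleftrightarrow> (\<exists>k::int. of_int k < s \<and> t < of_int k + 1)"

lemma open_side_shift: "open_side (s + real n) (t + real n) \<longleftrightarrow> open_side s t"
proof
  assume "open_side (s + real n) (t + real n)"
  then obtain k :: int where "of_int k < s + real n" "t + real n < of_int k + 1"
    by (auto simp: open_side_def)
  then show "open_side s t" unfolding open_side_def by (intro exI[of _ "k - int n"]) simp
next
  assume "open_side s t"
  then obtain k :: int where "of_int k < s" "t < of_int k + 1"
    by (auto simp: open_side_def)
  then show "open_side (s + real n) (t + real n)"
    unfolding open_side_def by (intro exI[of _ "k + int n"]) simp
qed

text \<open>Increasing parameters within one turn make cyclic position a comparison of reals. Moving
  the first one to the end, shifted by \<open>n\<close>, relabels the corners.\<close>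

definition stationary_params ::
    "(nat \<Rightarrow> pt) \<Rightarrow> nat \<Rightarrow> real \<Rightarrow> real \<Rightarrow> real \<Rightarrow> real \<Rightarrow> bool" where
  "stationary_params v n a b c d \<longleftrightarrow> a < b \<and> b < c \<and> c < d \<and> d < a + real n \<and>
     stationary (polygon v n) (bpar v n a) (bpar v n b) (bpar v n c) (bpar v n d) \<and>
     \<not> open_side a b \<and> \<not> open_side b c \<and> \<not> open_side c d \<and> \<not> open_side d (a + real n)"

lemma stationary_params_rotate:
  assumes "n > 0" "stationary_params v n a b c d"
  shows "stationary_params v n b c d (a + real n)"
  using assms stationary_rotate
  by (auto simp: stationary_params_def bpar_shift open_side_shift)

lemma stationary_params_rotate_back:
  assumes "n > 0" "stationary_params v n a b c d"
  shows "stationary_params v n (d - real n) a b c"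
  using assms stationary_rotate[OF stationary_rotate[OF stationary_rotate]]
    open_side_shift[of "d - real n" n a]
  by (auto simp: stationary_params_def bpar_shift)

text \<open>Three consecutive corners on one closed side would be collinear, against the positive
  area.\<close>

lemma stationary_params_not_one_side:
  assumes "n > 0" "stationary_params v n a b c d"
  shows "\<not> one_side a c" "\<not> one_side b d" "\<not> one_side c (a + real n)" "\<not> one_side d (b + real n)"
proof -
  have *: "\<not> one_side a c" if "stationary_params v n a b c d" for a b c d
  proof
    assume "one_side a c"
    then have "orient (bpar v n a) (bpar v n b) (bpar v n c) = 0"
      using that assms(1) by (intro orient_zero_one_side) (auto simp: stationary_params_def)
    moreover have "bpar v n a + bpar v n c = bpar v n b + bpar v n d"
      "cross (bpar v n b - bpar v n c) (bpar v n d - bpar v n c) > 0"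
      using that by (auto simp: stationary_params_def stationary_def)
    moreover from this(1) have "bpar v n d = bpar v n a + bpar v n c - bpar v n b"
      by (simp add: algebra_simps)
    ultimately show False by (simp add: orient_def cross_def algebra_simps)
  qed
  note rot = stationary_params_rotate[OF assms(1)]
  show "\<not> one_side a c" "\<not> one_side b d" "\<not> one_side c (a + real n)" "\<not> one_side d (b + real n)"
    using *[OF assms(2)] *[OF rot[OF assms(2)]] *[OF rot[OF rot[OF assms(2)]]]
      *[OF rot[OF rot[OF rot[OF assms(2)]]]] by auto
qed

text \<open>The assumption on \<open>y\<close> and \<open>z\<close> prevents the whole arc from
  \<open>a\<close> to \<open>b\<close> from lying on one side, so both points are strictly beyond
  the chord and \<open>stationary_cap_converges\<close> applies.\<close>

lemma cap_converges:
  assumes cw: "cw_convex_polygon v n" and st: "stationary_params v n a b c d"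
    and lt: "a < y" "y < z" "z < b" and no: "\<not> open_side y z"
  shows "cross (bpar v n y - bpar v n a) (bpar v n b - bpar v n z) < 0"
proof -
  have n: "n > 0" using cw by (simp add: cw_convex_polygon_def)
  note ns = stationary_params_not_one_side[OF n st]
  have ord: "a < b" "b < c" "c < d" "d < a + real n"
    and st': "stationary (polygon v n) (bpar v n a) (bpar v n b) (bpar v n c) (bpar v n d)"
    using st by (auto simp: stationary_params_def)
  have 1: "\<not> one_side a b"
  proof
    assume "one_side a b"
    then obtain k :: int where "of_int k \<le> a" "b \<le> of_int k + 1" by (auto simp: one_side_def)
    then have "open_side y z" using lt unfolding open_side_def by (intro exI[of _ k]) auto
    then show False using no by simp
  qed
  have "cross (bpar v n b - bpar v n a) (bpar v n x - bpar v n a) > 0" if x: "a < x" "x < b" for x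
  proof -
    have "\<not> one_side x (a + real n)" using ns(3) one_side_mono[of x "a + real n" c] x ord by auto
    moreover have "\<not> one_side b (x + real n)"
      using ns(2) one_side_mono[of b "x + real n" b d] x ord by auto
    ultimately have "orient (bpar v n a) (bpar v n x) (bpar v n b) < 0"
      using orient_neg_or_one_side[OF cw, of a x b] 1 x ord by auto
    then show ?thesis
      using cross_commute[of "bpar v n b - bpar v n a" "bpar v n x - bpar v n a"]
      by (simp add: orient_def)
  qed
  then show ?thesis
    using lt n by (intro stationary_cap_converges[OF convex_polygon st'] bpar_in_polygon) auto
qed

text \<open>Convergence is applied to the cap over \<open>b0 b1\<close>, which contains
  \<open>a0\<close> and \<open>a1\<close>, and to the cap over \<open>a3 a0\<close>, which contains
  \<open>b3\<close> and \<open>b0\<close>. This yields the two sign conditions of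
  \<open>stationary_pair_contradiction\<close>.\<close>

lemma no_crossing:
  assumes cw: "cw_convex_polygon v n"
    and A: "stationary_params v n a0 a1 a2 a3" and B: "stationary_params v n b0 b1 b2 b3"
    and "a3 \<le> b3" "b0 < a0" "a1 \<le> b1" "a1 \<noteq> b1 \<or> a3 \<noteq> b3"
  shows False
proof -
  have n: "n > 0" using cw by (simp add: cw_convex_polygon_def)
  let ?g = "bpar v n"
  have oA: "a0 < a1" "a1 < a2" "a2 < a3" "a3 < a0 + real n" "\<not> open_side a0 a1"
    and oB: "b0 < b1" "b1 < b2" "b2 < b3" "b3 < b0 + real n" "\<not> open_side b3 (b0 + real n)"
    and sA: "stationary (polygon v n) (?g a0) (?g a1) (?g a2) (?g a3)"
    and sB: "stationary (polygon v n) (?g b0) (?g b1) (?g b2) (?g b3)"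
    using A B by (auto simp: stationary_params_def)
  have 1: "a1 = b1 \<or> cross (?g a0 - ?g b0) (?g b1 - ?g a1) < 0"
    using cap_converges[OF cw B, of a0 a1] \<open>b0 < a0\<close> \<open>a1 \<le> b1\<close> oA by linarith
  have 3: "a3 = b3 \<or> cross (?g b3 - ?g a3) (?g a0 - ?g b0) < 0"
  proof (cases "a3 = b3")
    case False
    have "\<not> open_side (b3 - real n) b0" using open_side_shift[of "b3 - real n" n b0] oB by simp
    then show ?thesis
      using cap_converges[OF cw stationary_params_rotate_back[OF n A], of "b3 - real n" b0]
        \<open>a3 \<le> b3\<close> \<open>b0 < a0\<close> False oB by (simp add: bpar_shift[OF n])
  qed simp
  \<comment> \<open>Different parameters give different points here, because a cross product with
    the zero vector is not negative.\<close>
  have "?g a1 \<noteq> ?g b1 \<or> ?g a3 \<noteq> ?g b3" using 1 3 assms by (auto simp: cross_simps)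
  then show False
    using stationary_pair_contradiction[OF convex_polygon sA sB] 1 3 by auto
qed

text \<open>The situation at the other end of the arc. Relabelling both parallelograms by one corner
  and exchanging their roles replaces a reflection.\<close>

lemma no_crossing_mirror:
  assumes cw: "cw_convex_polygon v n"
    and A: "stationary_params v n a0 a1 a2 a3" and B: "stationary_params v n b0 b1 b2 b3"
    and "b0 < a0" "a1 < b1" "b2 \<le> a2"
  shows False
proof -
  have n: "n > 0" using cw by (simp add: cw_convex_polygon_def)
  show ?thesis
    using no_crossing[OF cw stationary_params_rotate[OF n B] stationary_params_rotate[OF n A]] assms
    by auto
qed

lemma no_nested_pair:
  assumes cw: "cw_convex_polygon v n" and np: "no_parallel_edges v n"
    and A: "stationary_params v n a0 a1 a2 a3" and B: "stationary_params v n b0 b1 b2 b3"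
    and ord: "b0 < a0" "a1 < b1" "b1 \<le> a2" "a2 < b2" "b3 < a3" "a3 \<le> b0 + real n"
  shows False
proof -
  have n: "n > 0" using cw by (simp add: cw_convex_polygon_def)
  let ?g = "bpar v n"
  have oA: "a0 < a1" "a1 < a2" "a2 < a3" "a3 < a0 + real n"
    and oB: "b0 < b1" "b1 < b2" "b2 < b3" "b3 < b0 + real n"
    and sA: "stationary (polygon v n) (?g a0) (?g a1) (?g a2) (?g a3)"
    and sB: "stationary (polygon v n) (?g b0) (?g b1) (?g b2) (?g b3)"
    using A B by (auto simp: stationary_params_def)
  define s where "s = ?g a3 - ?g a0"
  have s: "s = ?g a2 - ?g a1" and parB: "?g b1 - ?g b0 = ?g b2 - ?g b3"
    using sA sB by (auto simp: s_def stationary_def algebra_simps)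
  define F where "F = cross s (?g a1 - ?g a0)"
  have F: "F > 0"
  proof -
    have "?g a1 - ?g a0 = - (?g a3 - ?g a2)" "s = - (?g a1 - ?g a2)"
      using sA s by (auto simp: stationary_def algebra_simps)
    then have "F = cross (?g a1 - ?g a2) (?g a3 - ?g a2)" unfolding F_def by (simp only: cross_simps)
    then show ?thesis using sA by (simp add: stationary_def)
  qed
  \<comment> \<open>A scaled distance from the line \<open>a0 a3\<close>; it is 0 on that line and
    \<open>F\<close> on the line \<open>a1 a2\<close>, the borders of the strip.\<close>
  let ?f = "\<lambda>x. cross s (?g x - ?g a0)"
  have f1: "?f x = cross s (?g x - ?g a1) + F" for x
    by (simp add: F_def cross_simps)
  have f3: "orient (?g a0) (?g b3) (?g a3) = - ?f b3"
    using cross_commute[of "?g b3 - ?g a0" s] by (simp add: orient_def s_def)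
  have f2: "orient (?g a1) (?g a2) (?g b2) = ?f b2 - F"
    by (simp add: orient_def f1 flip: s)
  have "orient (?g a3) (?g b0) (?g a0) = ?f b0"
    by (simp add: orient_def s_def cross_def algebra_simps)
  moreover have "orient (?g a3) (?g b0) (?g a0) \<le> 0"
    using orient_nonpos[OF cw, of a3 "b0 + real n" "a0 + real n"] ord oA by (simp add: bpar_shift[OF n])
  moreover have "?f b1 - F \<ge> 0"
    using orient_nonpos[OF cw, of a1 b1 a2] ord oA cross_commute[of "?g b1 - ?g a1" s]
    by (simp add: orient_def f1 flip: s)
  moreover have "?f b3 \<ge> 0" using orient_nonpos[OF cw, of a0 b3 a3] ord oA oB f3 by auto
  moreover have "?f b2 \<le> F" using orient_nonpos[OF cw, of a1 a2 b2] ord oA oB f2 by auto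
  moreover have "?f b1 - ?f b0 = ?f b2 - ?f b3"
    using arg_cong[OF parB, of "cross s"] by (simp add: cross_simps)
  \<comment> \<open>The difference is at least \<open>F\<close> for \<open>b0, b1\<close> outside
    the strip and at most \<open>F\<close> for \<open>b3, b2\<close> inside it, so equality holds
    throughout.\<close>
  ultimately have "?f b3 = 0" "?f b2 = F" by linarith+
  then have z: "orient (?g a0) (?g b3) (?g a3) = 0" "orient (?g a1) (?g a2) (?g b2) = 0"
    using f3 f2 by auto
  note ns = stationary_params_not_one_side[OF n A]
  \<comment> \<open>Collinear boundary points share a closed side; the other two cyclic arrangements
    would put three corners of the first parallelogram on one side.\<close>
  have "one_side b3 (a0 + real n)"
    using orient_neg_or_one_side[OF cw, of a0 b3 a3] z ord oA oB ns
      one_side_mono[of a0 a3 a0 a2] one_side_mono[of a3 "b3 + real n" a3 "a1 + real n"] by auto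
  then obtain k :: int where k: "of_int k \<le> b3" "a0 + real n \<le> of_int k + 1" by (auto simp: one_side_def)
  have "one_side a1 b2"
    using orient_neg_or_one_side[OF cw, of a1 a2 b2] z ord oA oB ns
      one_side_mono[of a2 "a1 + real n" a2 "a0 + real n"]
      one_side_mono[of b2 "a2 + real n" a3 "a1 + real n"] by auto
  then obtain l :: int where l: "of_int l \<le> a1" "b2 \<le> of_int l + 1" by (auto simp: one_side_def)
  have sk: "\<exists>x. x \<noteq> 0 \<and> s = x *\<^sub>R side v n k"
    using bpar_same_side_diff[OF n, of k "a0 + real n" a3 v] k ord oA
    by (intro exI[of _ "a3 - (a0 + real n)"]) (auto simp: s_def bpar_shift[OF n])
  have sl: "\<exists>x. x \<noteq> 0 \<and> s = x *\<^sub>R side v n l"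
    using bpar_same_side_diff[OF n, of l a1 a2 v] l ord oA
    by (intro exI[of _ "a2 - a1"]) (auto simp: s)
  obtain x y where x: "x \<noteq> 0" "s = x *\<^sub>R side v n k" and y: "y \<noteq> 0" "s = y *\<^sub>R side v n l"
    using sk sl by blast
  have "x * (y * cross (side v n k) (side v n l)) = cross s s"
    by (subst (1) x(2), subst y(2)) (simp add: cross_simps)
  then have par: "cross (side v n k) (side v n l) = 0" using x y by (simp add: cross_simps)
  \<comment> \<open>If both borders lie along the same edge, the strip has width zero, against
    \<open>F > 0\<close>; otherwise two distinct edges are parallel.\<close>
  show False
  proof (cases "k mod int n = l mod int n")
    case True
    have "?g a1 - ?g a0 = (vtx v n l + (a1 - of_int l) *\<^sub>R side v n l) -
        (vtx v n k + (a0 + real n - of_int k) *\<^sub>R side v n k)"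
      using bpar_on_side[OF n, of l a1 v] bpar_on_side[OF n, of k "a0 + real n" v] k l ord oA oB
      by (simp add: bpar_shift[OF n])
    also have "\<dots> = ((a1 - of_int l) - (a0 + real n - of_int k)) *\<^sub>R side v n k"
      using vtx_mod_eq[OF True, of v] side_mod_eq[OF True, of v] by (simp add: algebra_simps)
    finally have "F = 0" unfolding F_def x(2) by (simp add: cross_simps)
    then show False using F by simp
  next
    case False
    let ?k = "nat (k mod int n)" and ?l = "nat (l mod int n)"
    have "?k < n" "?l < n" "?k \<noteq> ?l" using False n by (auto simp: nat_less_iff eq_nat_nat_iff)
    then have "cross (v (Suc ?k mod n) - v ?k) (v (Suc ?l mod n) - v ?l) \<noteq> 0"
      using np by (simp add: no_parallel_edges_def)
    then show False using par nat_Suc_mod[OF n] by (simp add: side_def vtx_def)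
  qed
qed

text \<open>The two crossing lemmas leave only the nested position, which
  \<open>no_nested_pair\<close> excludes.\<close>

lemma no_enclosed_side:
  assumes cw: "cw_convex_polygon v n" and np: "no_parallel_edges v n"
    and A: "stationary_params v n a0 a1 a2 a3" and B: "stationary_params v n b0 b1 b2 b3"
    and "b0 < a0" "a1 < b1"
  shows False
proof -
  have n: "n > 0" using cw by (simp add: cw_convex_polygon_def)
  have oA: "a0 < a1" "a1 < a2" "a2 < a3" "a3 < a0 + real n"
    and oB: "b0 < b1" "b1 < b2" "b2 < b3" "b3 < b0 + real n"
    using A B by (auto simp: stationary_params_def)
  have "b3 < a3" using no_crossing[OF cw A B] assms by force
  moreover have "a2 < b2" using no_crossing_mirror[OF cw A B] assms by force
  \<comment> \<open>Otherwise \<open>a1\<close> and \<open>a2\<close> both lie between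
    \<open>b0\<close> and \<open>b1\<close>, and the mirrored lemma applies to the relabelled
    corners; \<open>a3\<close> is treated likewise with \<open>a3 - real n\<close> and
    \<open>a0\<close>.\<close>
  moreover have "b1 \<le> a2"
    using no_crossing_mirror[OF cw stationary_params_rotate[OF n A] B] assms oA oB calculation by force
  moreover have "a3 \<le> b0 + real n"
    using no_crossing[OF cw stationary_params_rotate_back[OF n A] B] assms oA oB calculation by force
  ultimately show False using no_nested_pair[OF cw np A B] assms by blast
qed

section \<open>Parameters for the corners of an LMAP, and the final contradiction\<close>

definition separated :: "(nat \<Rightarrow> pt) \<Rightarrow> nat \<Rightarrow> pt \<Rightarrow> pt \<Rightarrow> bool" where
  "separated v n p q \<longleftrightarrow> (\<forall>e<n. \<not> (p \<in> edge v n e \<and> q \<in> edge v n e))"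

lemma not_open_side_separated:
  assumes cw: "cw_convex_polygon v n" and "separated v n (bpar v n s) (bpar v n t)" "s < t"
  shows "\<not> open_side s t"
proof
  have n: "n > 0" using cw by (simp add: cw_convex_polygon_def)
  assume "open_side s t"
  then obtain k :: int where k: "of_int k < s" "t < of_int k + 1" by (auto simp: open_side_def)
  have "bpar v n x \<in> edge v n (nat (k mod int n))" if "of_int k < x" "x < of_int k + 1" for x
  proof -
    have "edge v n (nat (k mod int n)) = open_segment (vtx v n k) (vtx v n (k + 1))"
      using nat_Suc_mod[OF n, of k] by (simp add: edge_def vtx_def)
    moreover have "vtx v n k \<noteq> vtx v n (k + 1)" using side_nonzero[OF cw, of k] by (auto simp: side_def)
    ultimately show ?thesis
      using bpar_convex_comb[OF n, of k x v] that
      by (auto simp: in_segment intro!: exI[of _ "x - of_int k"])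
  qed
  moreover have "nat (k mod int n) < n" using n by (auto simp: nat_less_iff)
  ultimately show False using assms k unfolding separated_def
    by (metis less_trans)
qed

lemma bpar_param_from:
  assumes "n > 0" "x \<in> range (bpar v n)"
  obtains t where "c \<le> t" "t < c + real n" "bpar v n t = x"
proof -
  obtain u where u: "bpar v n u = x" using assms by auto
  define k where "k = \<lfloor>(u - c) / real n\<rfloor>"
  have "of_int k \<le> (u - c) / real n" "(u - c) / real n < of_int k + 1"
    unfolding k_def by linarith+
  then have "of_int k * real n \<le> u - c" "u - c < (of_int k + 1) * real n"
    using assms by (simp_all add: pos_le_divide_eq pos_divide_less_eq)
  then have "c \<le> u + of_int (- k) * real n" "u + of_int (- k) * real n < c + real n"
    by (simp_all add: algebra_simps)
  then show ?thesis using that bpar_shift_int[OF assms(1), of v u "- k"] u by blast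
qed

definition spread_out :: "(nat \<Rightarrow> pt) \<Rightarrow> nat \<Rightarrow> pt \<Rightarrow> pt \<Rightarrow> pt \<Rightarrow> pt \<Rightarrow> bool" where
  "spread_out v n p q r s \<longleftrightarrow> stationary (polygon v n) p q r s \<and> separated v n p q \<and>
     separated v n q r \<and> separated v n r s \<and> separated v n s p"

lemma spread_out_rotate: "spread_out v n p q r s \<Longrightarrow> spread_out v n q r s p"
  by (auto simp: spread_out_def stationary_rotate)

lemma stationary_paramsI:
  assumes cw: "cw_convex_polygon v n"
    and "spread_out v n (bpar v n a) (bpar v n b) (bpar v n c) (bpar v n d)"
    and "a < b" "b < c" "c < d" "d < a + real n"
  shows "stationary_params v n a b c d"
proof -
  have n: "n > 0" using cw by (simp add: cw_convex_polygon_def)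
  show ?thesis
    using assms not_open_side_separated[OF cw, of d "a + real n"] not_open_side_separated[OF cw]
    by (simp add: stationary_params_def spread_out_def bpar_shift[OF n])
qed

text \<open>Stationary corners are boundary points, so each has a parameter in the turn starting at
  \<open>x\<close>, and positive area forces the clockwise order. Only the corner that comes first
  is undetermined.\<close>

lemma spread_out_params:
  assumes cw: "cw_convex_polygon v n" and so: "spread_out v n p q r s"
  obtains a b c d where "stationary_params v n a b c d" "x \<le> a" "d < x + real n"
    "(bpar v n a, bpar v n b, bpar v n c, bpar v n d) \<in> {(p, q, r, s), (q, r, s, p), (r, s, p, q), (s, p, q, r)}"
proof -
  have n: "n > 0" using cw by (simp add: cw_convex_polygon_def)
  note rot = spread_out_rotate
  have "y \<in> range (bpar v n)" if "spread_out v n y q r s" for y q r s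
    using that stationary_not_rel_interior[OF convex_polygon, of v n y q r s]
    by (intro polygon_boundary[OF cw]) (auto simp: spread_out_def stationary_def)
  then have mem: "p \<in> range (bpar v n)" "q \<in> range (bpar v n)" "r \<in> range (bpar v n)" "s \<in> range (bpar v n)"
    using so rot[OF so] rot[OF rot[OF so]] rot[OF rot[OF rot[OF so]]] by blast+
  obtain a where a: "x \<le> a" "a < x + real n" "bpar v n a = p" using bpar_param_from[OF n mem(1)] by blast
  obtain b where b: "x \<le> b" "b < x + real n" "bpar v n b = q" using bpar_param_from[OF n mem(2)] by blast
  obtain c where c: "x \<le> c" "c < x + real n" "bpar v n c = r" using bpar_param_from[OF n mem(3)] by blast
  obtain d where d: "x \<le> d" "d < x + real n" "bpar v n d = s" using bpar_param_from[OF n mem(4)] by blast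
  \<comment> \<open>Every other order of the three parameters is counterclockwise up to ties, which
    \<open>orient_nonpos\<close> refutes. Applied to all four consecutive triples, this fixes the
    cyclic order of the four corners.\<close>
  have cyc: "a < b \<and> b < c \<or> b < c \<and> c < a \<or> c < a \<and> a < b"
    if "x \<le> a" "a < x + real n" "x \<le> b" "b < x + real n" "x \<le> c" "c < x + real n"
      and so: "spread_out v n (bpar v n a) (bpar v n b) (bpar v n c) s" for a b c s
  proof -
    have neg: "orient (bpar v n a) (bpar v n b) (bpar v n c) < 0"
    proof -
      have *: "bpar v n a + bpar v n c = bpar v n b + s" "cross (bpar v n b - bpar v n c) (s - bpar v n c) > 0"
        using so by (auto simp: spread_out_def stationary_def)
      have "s - bpar v n c = bpar v n a - bpar v n b" using *(1) by (simp add: algebra_simps)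
      with *(2) have "cross (bpar v n b - bpar v n c) (bpar v n a - bpar v n b) > 0" by (simp only:)
      then show ?thesis by (simp add: orient_def cross_def algebra_simps)
    qed
    show ?thesis
    proof (rule ccontr)
      assume "\<not> ?thesis"
      then consider "a \<le> c" "c \<le> b" | "c \<le> b" "b \<le> a" | "b \<le> a" "a \<le> c" by linarith
      then have "orient (bpar v n a) (bpar v n c) (bpar v n b) \<le> 0"
      proof cases
        case 1
        then show ?thesis using that by (intro orient_nonpos[OF cw]) auto
      next
        case 2
        then show ?thesis using that orient_nonpos[OF cw, of c b a]
            orient_rotate[of "bpar v n c" "bpar v n b" "bpar v n a"] by auto
      next
        case 3
        then show ?thesis using that orient_nonpos[OF cw, of b a c]
            orient_rotate[of "bpar v n a" "bpar v n c" "bpar v n b"] by auto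
      qed
      then show False
        using neg cross_commute[of "bpar v n c - bpar v n a" "bpar v n b - bpar v n a"]
        by (simp add: orient_def)
    qed
  qed
  have so1: "spread_out v n (bpar v n a) (bpar v n b) (bpar v n c) (bpar v n d)"
    using so a b c d by simp
  note so2 = rot[OF so1]
  note so3 = rot[OF so2]
  note so4 = rot[OF so3]
  have "a < b \<and> b < c \<and> c < d \<or> b < c \<and> c < d \<and> d < a \<or> c < d \<and> d < a \<and> a < b \<or> d < a \<and> a < b \<and> b < c"
    using cyc[OF a(1,2) b(1,2) c(1,2) so1] cyc[OF b(1,2) c(1,2) d(1,2) so2]
      cyc[OF c(1,2) d(1,2) a(1,2) so3] cyc[OF d(1,2) a(1,2) b(1,2) so4] by linarith
  then consider "a < b" "b < c" "c < d" | "b < c" "c < d" "d < a" | "c < d" "d < a" "a < b"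
    | "d < a" "a < b" "b < c" by blast
  then show ?thesis
  proof cases
    case 1
    then show ?thesis using that[OF stationary_paramsI[OF cw so1]] a b c d by auto
  next
    case 2
    then show ?thesis using that[OF stationary_paramsI[OF cw so2]] a b c d by auto
  next
    case 3
    then show ?thesis using that[OF stationary_paramsI[OF cw so3]] a b c d by auto
  next
    case 4
    then show ?thesis using that[OF stationary_paramsI[OF cw so4]] a b c d by auto
  qed
qed

text \<open>The complementary choice: the first corner is prescribed and the turn in which the
  parameters lie is left free.\<close>

lemma spread_out_params_start:
  assumes cw: "cw_convex_polygon v n" and so: "spread_out v n p q r s"
  obtains a b c d where "stationary_params v n a b c d" "bpar v n a = p" "bpar v n b = q"
proof -
  have n: "n > 0" using cw by (simp add: cw_convex_polygon_def)
  obtain a b c d where st: "stationary_params v n a b c d" and "0 \<le> a" "d < 0 + real n"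
    and eq: "(bpar v n a, bpar v n b, bpar v n c, bpar v n d) \<in> {(p, q, r, s), (q, r, s, p), (r, s, p, q), (s, p, q, r)}"
    by (rule spread_out_params[OF cw so])
  note st2 = stationary_params_rotate[OF n st]
  note st3 = stationary_params_rotate[OF n st2]
  note st4 = stationary_params_rotate[OF n st3]
  show ?thesis
    using eq that[OF st] that[OF st2] that[OF st3] that[OF st4]
    by (elim insertE emptyE) (simp_all add: bpar_shift[OF n])
qed

lemma LMAP_spread_out:
  assumes "LMAP v n A" "clockwise_par A"
  shows "spread_out v n (A 0) (A 1) (A 2) (A 3)"
proof -
  have sep: "separated v n (A i) (A j)" if "i < 4" "j < 4" "i \<noteq> j" for i j
    using assms that unfolding separated_def LMAP_def slidable_def by blast
  have "locally_maximal v n A" using assms by (simp add: LMAP_def)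
  then show ?thesis
    using locally_maximal_stationary[OF _ assms(2)] sep by (simp add: spread_out_def)
qed

text \<open>Parameters of \<open>B\<close> are taken in the turn starting at \<open>a0\<close>. If
  no corner of \<open>B\<close> is on the arc, the first one, \<open>b0\<close>, comes after
  \<open>a1\<close>, and its predecessor \<open>b3 - real n\<close> comes before \<open>a0\<close>.
  So \<open>a0\<close> and \<open>a1\<close> lie strictly between consecutive corners of
  \<open>B\<close>.\<close>

lemma LMAP_corner_in_arc:
  assumes cw: "cw_convex_polygon v n" and np: "no_parallel_edges v n"
    and A: "LMAP v n A" "clockwise_par A" and B: "LMAP v n B" "clockwise_par B" and "i < 4"
  shows "\<exists>j<4. B j \<in> cw_arc v n (A i) (A (Suc i mod 4))"
proof (rule ccontr)
  assume no: "\<not> ?thesis"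
  have n: "n > 0" using cw by (simp add: cw_convex_polygon_def)
  note soA = LMAP_spread_out[OF A]
  have "\<exists>r s. spread_out v n (A i) (A (Suc i mod 4)) r s"
  proof -
    note soA1 = spread_out_rotate[OF soA]
    note soA2 = spread_out_rotate[OF soA1]
    note soA3 = spread_out_rotate[OF soA2]
    consider "i = 0" | "i = 1" | "i = 2" | "i = 3" using \<open>i < 4\<close> by linarith
    then show ?thesis
    proof cases
      case 1
      then have "Suc i mod 4 = 1" by simp
      then show ?thesis using soA 1 by metis
    next
      case 2
      then have "Suc i mod 4 = 2" by simp
      then show ?thesis using soA1 2 by metis
    next
      case 3
      then have "Suc i mod 4 = 3" by simp
      then show ?thesis using soA2 3 by metis
    next
      case 4
      then have "Suc i mod 4 = 0" by simp
      then show ?thesis using soA3 4 by metis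
    qed
  qed
  then obtain a0 a1 a2 a3 where a: "stationary_params v n a0 a1 a2 a3"
    "bpar v n a0 = A i" "bpar v n a1 = A (Suc i mod 4)"
    using spread_out_params_start[OF cw] by blast
  obtain b0 b1 b2 b3 where b: "stationary_params v n b0 b1 b2 b3" "a0 \<le> b0" "b3 < a0 + real n"
    "(bpar v n b0, bpar v n b1, bpar v n b2, bpar v n b3) \<in>
      {(B 0, B 1, B 2, B 3), (B 1, B 2, B 3, B 0), (B 2, B 3, B 0, B 1), (B 3, B 0, B 1, B 2)}"
    by (rule spread_out_params[OF cw LMAP_spread_out[OF B]])
  have "bpar v n b0 \<in> B ` {..<4}" using b(4) by auto
  then have "bpar v n b0 \<notin> cw_arc v n (A i) (A (Suc i mod 4))" using no by auto
  moreover have "a0 < a1" "a1 < a0 + real n" using a(1) by (auto simp: stationary_params_def)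
  \<comment> \<open>Otherwise \<open>a0\<close>, \<open>a1\<close> and \<open>b0\<close> would
    witness that this corner belongs to \<open>cw_arc\<close>.\<close>
  ultimately have "a1 < b0"
    using a(2,3) b(2) unfolding cw_arc_def by force
  moreover have "b3 - real n < a0" using b by simp
  ultimately show False
    using no_enclosed_side[OF cw np a(1) stationary_params_rotate_back[OF n b(1)]] by blast
qed

theorem theorem3:
  fixes v :: "nat \<Rightarrow> real \<times> real" and n :: nat and A B :: "nat \<Rightarrow> real \<times> real"
  assumes "cw_convex_polygon v n"
    and "no_parallel_edges v n"
    and "LMAP v n A" and "clockwise_par A"
    and "LMAP v n B" and "clockwise_par B"
  shows "interleave v n 4 A B"
  unfolding interleave_def
  using LMAP_corner_in_arc[OF assms] LMAP_corner_in_arc[OF assms(1,2,5,6,3,4)] by simp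

end
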